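(* Assume that $F=\frac1n\sum_{i=1}^n f_i$ is a $\mu$-Polyak-Łojasiewicz function, that its set of global minimizers $\mathcal X^*$ is nonempty and compact, and that each $f_i\in C_L^1(\mathbb R^d)$. Consider RandomShuffle with initialization $\boldsymbol x_0$, run for a number of epochs $K$ satisfying $K\ge 10\,\kappa\log(n^{1/2}K)$, with constant step size $\eta_i^k=\eta:=\frac{2\log(n^{1/2}K)}{\mu nK}$ for all $i\in[n]$, $k\in[K]$. Let $\delta\in(0,1)$. Then, with probability at least $1-\delta$ (over the random permutations), the following holds for some $c=O(\kappa^3)$: $$\min_{k\in[K+1]}F(\boldsymbol x_0^k)-F^*\;\le\;\frac{F(\boldsymbol x_0)-F^*}{nK^2}+\frac{c\cdot\log^2(nK)\,\log\frac{nK}{\delta}}{nK^2}.$$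
   Context: Setting: $n\ge2$ and $d\ge1$ are integers, $f_1,\dots,f_n:\mathbb R^d\to\mathbb R$ are differentiable, $F:=\frac1n\sum_{i=1}^n f_i$, $F^*:=\min_{\boldsymbol x}F(\boldsymbol x)$, $[a]:=\{1,\dots,a\}$, $\|\cdot\|$ is the Euclidean norm, $\log$ is the natural logarithm, $L,\mu>0$, and $\kappa:=L/\mu$. $C_L^1(\mathbb R^d)$ is the class of differentiable $L$-smooth functions on $\mathbb R^d$, i.e. differentiable functions with $L$-Lipschitz gradient. A differentiable $h$ is $\mu$-Polyak-Łojasiewicz if $\frac12\|\nabla h(\boldsymbol x)\|^2\ge\mu\,(h(\boldsymbol x)-h^* )$ for all $\boldsymbol x\in\mathbb R^d$, where $h^*=\min h$. RandomShuffle: set $\boldsymbol x_0^1:=\boldsymbol x_0$. In each epoch $k=1,\dots,K$ draw a permutation $\sigma_k$ of $[n]$ uniformly at random, independently across epochs, and for $i=1,\dots,n$ set $\boldsymbol x_i^k:=\boldsymbol x_{i-1}^k-\eta_i^k\nabla f_{\sigma_k(i)}(\boldsymbol x_{i-1}^k)$; then set $\boldsymbol x_0^{k+1}:=\boldsymbol x_n^k$. Meaning of $c=O(\kappa^3)$: let $G:=\sup\{\max_{i\in[n]}\|\nabla f_i(\boldsymbol x)\| : F(\boldsymbol x)\le F(\boldsymbol x_0)\}$ (finite under the assumptions). The paper uses the convention $\kappa=\Theta(1/\mu)$, so $L$ and $G$ are treated as constants: $c\le C\kappa^3$ where $C$ depends only on $L$ and $G$ (not on $\mu,n,K,d,\delta$).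 *)

theory Defs
  imports "HOL-Analysis.Analysis" "HOL-Probability.Probability" "HOL-Probability.Product_PMF"
    "HOL-Combinatorics.Permutations"
begin

section \<open>Euclidean space of variable dimension\<close>

text \<open>
  The constant in the final bound may depend neither on the dimension nor on the number of
  component functions, so the dimension \<open>d\<close> has to be a number that can be quantified inside a
  formula and not a type. A point of \<open>d\<close>-space is therefore a sequence that vanishes from index \<open>d\<close>
  on, as in \<^const>\<open>Euclidean_space\<close>, the norm is \<^const>\<open>L2_set\<close>, and functions on \<open>d\<close>-space are
  only ever looked at on this carrier. The topology of the type \<^typ>\<open>nat \<Rightarrow> real\<close> (the product
  topology) induces on the carrier the usual topology of \<open>d\<close>-space. The library metric on
  \<^typ>\<open>nat \<Rightarrow> real\<close> is not the Euclidean one and is not used.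
\<close>

type_synonym vec = "nat \<Rightarrow> real"

definition Rd :: "nat \<Rightarrow> vec set" where
  "Rd d = topspace (Euclidean_space d)"

definition enorm :: "nat \<Rightarrow> vec \<Rightarrow> real" where
  "enorm d x = L2_set x {..<d}"

lemma mem_Rd_iff: "x \<in> Rd d \<longleftrightarrow> (\<forall>i\<ge>d. x i = 0)"
  by (simp add: Rd_def topspace_Euclidean_space)

lemma Euclidean_space_eq_top_of_set: "Euclidean_space d = top_of_set (Rd d)"
  by (simp add: Rd_def Euclidean_space_def euclidean_product_topology)

section \<open>Gradients and function classes\<close>

text \<open>Frechet differentiability, with the derivative represented by the vector \<open>g\<close>.\<close>

definition has_gradient :: "nat \<Rightarrow> (vec \<Rightarrow> real) \<Rightarrow> vec \<Rightarrow> vec \<Rightarrow> bool" where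
  "has_gradient d h g x \<longleftrightarrow> g \<in> Rd d \<and>
     ((\<lambda>y. (h y - h x - (\<Sum>i<d. g i * (y i - x i))) / enorm d (\<lambda>i. y i - x i))
        \<longlongrightarrow> 0) (at x within Rd d)"

definition differentiable_Rd :: "nat \<Rightarrow> (vec \<Rightarrow> real) \<Rightarrow> bool" where
  "differentiable_Rd d h \<longleftrightarrow> (\<forall>x\<in>Rd d. \<exists>g. has_gradient d h g x)"

definition grad :: "nat \<Rightarrow> (vec \<Rightarrow> real) \<Rightarrow> vec \<Rightarrow> vec" where
  "grad d h x = (THE g. has_gradient d h g x)"

lemma has_gradient_unique:
  assumes x: "x \<in> Rd d" and 1: "has_gradient d h g x" and 2: "has_gradient d h g' x"
  shows "g = g'"
proof (rule ccontr)
  assume ne: "g \<noteq> g'"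
  define v where "v = (\<lambda>i. g i - g' i)"
  have g: "g \<in> Rd d" "g' \<in> Rd d" using 1 2 by (auto simp: has_gradient_def)
  from ne obtain j where j: "g j \<noteq> g' j" by auto
  then have "j < d" using g by (metis mem_Rd_iff not_le)
  have "enorm d v \<noteq> 0"
    using j \<open>j < d\<close> by (auto simp: enorm_def L2_set_eq_0_iff v_def)
  then have npos: "enorm d v > 0"
    by (simp add: enorm_def L2_set_nonneg less_le)
  have sq: "(\<Sum>i<d. v i * v i) = (enorm d v)\<^sup>2"
    by (simp add: enorm_def L2_set_def sum_nonneg power2_eq_square)
  define p where "p = (\<lambda>t::real. \<lambda>i. x i + t * v i)"
  have "continuous_on UNIV p"
    unfolding p_def
    by (intro continuous_on_coordinatewise_then_product continuous_intros)
  then have "(p \<longlongrightarrow> p 0) (at 0)"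
    by (simp add: continuous_on_def)
  then have lim: "(p \<longlongrightarrow> x) (at_right 0)"
    by (auto simp: p_def intro: tendsto_within_subset)
  have "\<forall>\<^sub>F t in at_right 0. p t \<in> Rd d \<and> p t \<noteq> x"
    unfolding eventually_at_filter
  proof (intro always_eventually allI impI)
    fix t :: real assume "t \<noteq> 0" "t \<in> {0<..}"
    then have "p t j \<noteq> x j" using j by (simp add: p_def v_def)
    moreover have "p t \<in> Rd d" using x g by (auto simp: p_def mem_Rd_iff v_def)
    ultimately show "p t \<in> Rd d \<and> p t \<noteq> x" by auto
  qed
  with lim have fl: "filterlim p (at x within Rd d) (at_right 0)"
    by (auto simp: filterlim_at)
  let ?q = "\<lambda>g y. (h y - h x - (\<Sum>i<d. g i * (y i - x i))) / enorm d (\<lambda>i. y i - x i)"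
  have "((\<lambda>y. ?q g' y - ?q g y) \<longlongrightarrow> 0 - 0) (at x within Rd d)"
    using 1 2 unfolding has_gradient_def by (intro tendsto_diff) auto
  from filterlim_compose[OF this fl]
  have L: "((\<lambda>t. ?q g' (p t) - ?q g (p t)) \<longlongrightarrow> 0) (at_right 0)" by simp
  have "\<forall>\<^sub>F t in at_right 0. ?q g' (p t) - ?q g (p t) = enorm d v"
    unfolding eventually_at_filter
  proof (intro always_eventually allI impI)
    fix t :: real assume "t \<noteq> 0" "t \<in> {0<..}"
    then have t: "t > 0" by simp
    have e: "enorm d (\<lambda>i. p t i - x i) = t * enorm d v"
      using t by (simp add: p_def enorm_def L2_set_right_distrib)
    have "?q g' (p t) - ?q g (p t)
        = ((\<Sum>i<d. g i * (p t i - x i)) - (\<Sum>i<d. g' i * (p t i - x i)))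
            / enorm d (\<lambda>i. p t i - x i)"
      by (simp add: diff_divide_distrib [symmetric])
    also have "(\<Sum>i<d. g i * (p t i - x i)) - (\<Sum>i<d. g' i * (p t i - x i))
        = t * (\<Sum>i<d. v i * v i)"
      by (simp add: sum_subtractf [symmetric] sum_distrib_left p_def v_def algebra_simps)
    finally show "?q g' (p t) - ?q g (p t) = enorm d v"
      using t npos by (simp add: e sq power2_eq_square)
  qed
  with L have "((\<lambda>_. enorm d v) \<longlongrightarrow> 0) (at_right (0::real))"
    by (simp add: tendsto_cong)
  then show False using npos by (simp add: tendsto_const_iff)
qed

lemma grad_eqI: "x \<in> Rd d \<Longrightarrow> has_gradient d h g x \<Longrightarrow> grad d h x = g"
  unfolding grad_def by (rule the_equality) (auto intro: has_gradient_unique)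

definition smooth_class :: "nat \<Rightarrow> real \<Rightarrow> (vec \<Rightarrow> real) set" where
  "smooth_class d L = {h. differentiable_Rd d h \<and>
     (\<forall>x\<in>Rd d. \<forall>y\<in>Rd d.
        enorm d (\<lambda>j. grad d h x j - grad d h y j) \<le> L * enorm d (\<lambda>j. x j - y j))}"

definition minimizers :: "nat \<Rightarrow> (vec \<Rightarrow> real) \<Rightarrow> vec set" where
  "minimizers d h = {x\<in>Rd d. \<forall>y\<in>Rd d. h x \<le> h y}"

text \<open>An infimum that is a minimum whenever \<^term>\<open>minimizers d h\<close> is nonempty.\<close>

definition min_value :: "nat \<Rightarrow> (vec \<Rightarrow> real) \<Rightarrow> real" where
  "min_value d h = (INF x\<in>Rd d. h x)"

lemma min_value_eq: "x \<in> minimizers d h \<Longrightarrow> min_value d h = h x"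
  unfolding min_value_def minimizers_def by (intro cInf_eq_minimum) auto

definition polyak_lojasiewicz :: "nat \<Rightarrow> real \<Rightarrow> (vec \<Rightarrow> real) \<Rightarrow> bool" where
  "polyak_lojasiewicz d \<mu> h \<longleftrightarrow> differentiable_Rd d h \<and> minimizers d h \<noteq> {} \<and>
     (\<forall>x\<in>Rd d. 1 / 2 * (enorm d (grad d h x))\<^sup>2 \<ge> \<mu> * (h x - min_value d h))"

section \<open>Finite sums and RandomShuffle\<close>

definition avg :: "nat \<Rightarrow> (nat \<Rightarrow> vec \<Rightarrow> real) \<Rightarrow> vec \<Rightarrow> real" where
  "avg n f x = (\<Sum>i=1..n. f i x) / real n"

text \<open>
  The supremum is taken in the reals and is meaningful only if the gradients are bounded on the
  sublevel set. They are if \<^term>\<open>avg n f\<close> is Polyak-Lojasiewicz with a compact set of minimizers and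
  all \<^term>\<open>f i\<close> are smooth, since then the sublevel sets are compact.
\<close>

definition grad_bound :: "nat \<Rightarrow> nat \<Rightarrow> (nat \<Rightarrow> vec \<Rightarrow> real) \<Rightarrow> vec \<Rightarrow> real" where
  "grad_bound d n f x0 =
     (SUP x\<in>{x\<in>Rd d. avg n f x \<le> avg n f x0}. MAX i\<in>{1..n}. enorm d (grad d (f i) x))"

text \<open>
  \<^term>\<open>shuffle_iter d n f \<eta> \<sigma> x0 k i\<close> is the iterate after \<open>i\<close> steps of epoch \<open>k\<close>, for
  \<open>k \<ge> 1\<close>. The fictitious epoch \<open>0\<close> stays at \<open>x0\<close>, so that epoch \<open>1\<close> starts there.
\<close>

fun shuffle_iter ::
  "nat \<Rightarrow> nat \<Rightarrow> (nat \<Rightarrow> vec \<Rightarrow> real) \<Rightarrow> (nat \<Rightarrow> nat \<Rightarrow> real) \<Rightarrow> (nat \<Rightarrow> nat \<Rightarrow> nat) \<Rightarrow> vec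
    \<Rightarrow> nat \<Rightarrow> nat \<Rightarrow> vec" where
  "shuffle_iter d n f \<eta> \<sigma> x0 0 i = x0"
| "shuffle_iter d n f \<eta> \<sigma> x0 (Suc k) 0 = shuffle_iter d n f \<eta> \<sigma> x0 k n"
| "shuffle_iter d n f \<eta> \<sigma> x0 (Suc k) (Suc i) =
     (let x = shuffle_iter d n f \<eta> \<sigma> x0 (Suc k) i
      in (\<lambda>j. x j - \<eta> (Suc k) (Suc i) * grad d (f (\<sigma> (Suc k) (Suc i))) x j))"

text \<open>Independent uniform permutations of \<open>{1..n}\<close> for the epochs \<open>1, \<dots>, K\<close>.\<close>

definition shuffles_pmf :: "nat \<Rightarrow> nat \<Rightarrow> (nat \<Rightarrow> nat \<Rightarrow> nat) pmf" where
  "shuffles_pmf n K = Pi_pmf {1..K} id (\<lambda>_. pmf_of_set {p. p permutes {1..n}})"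

end

theory Submission
  imports Defs
begin

text \<open>
  In one epoch started at \<open>x\<close> the method makes a gradient step of size \<open>\<eta> n\<close> for the average \<open>F\<close> up to
  an error controlled by \<open>\<eta> L (n \<parallel>\<nabla>F(x)\<parallel> + D)\<close>, where \<open>D\<close> bounds the deviation of the
  partial sums \<open>\<Sum>j\<le>i. \<nabla>f\<^bsub>\<sigma>(j)\<^esub>(x)\<close> from \<open>i \<nabla>F(x)\<close>. Since \<open>\<eta> n L \<le> 1/5\<close>, the first part
  is absorbed by the descent, and the gap \<open>F - F\<^sup>*\<close> contracts by \<open>1 - \<eta> n \<mu>\<close> up to the additive noise
  \<open>8 \<eta> n L\<^sup>2 \<eta>\<^sup>2 D\<^sup>2\<close>. An exponential potential along the Doob martingale of sampling without
  replacement gives \<open>D\<^sup>2 = O(n G\<^sup>2 log (nK/\<delta>))\<close> simultaneously for all partial sums and epochs with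
  probability \<open>1 - \<delta>\<close>, independently of the dimension. Unless the gap falls below the noise level,
  it decreases, so the iterates stay in the sublevel set on which \<open>G\<close> bounds the gradients;
  \<open>G\<close> is finite because gradient descent connects every point to a minimizer by a path of bounded
  length.
\<close>

section \<open>Euclidean geometry on sequences\<close>

definition eip :: "nat \<Rightarrow> vec \<Rightarrow> vec \<Rightarrow> real" where
  "eip d x y = (\<Sum>i<d. x i * y i)"

lemma enorm_nonneg [simp]: "0 \<le> enorm d x"
  by (simp add: enorm_def)

lemma enorm_power2: "(enorm d x)\<^sup>2 = eip d x x"
  by (simp add: enorm_def L2_set_def eip_def sum_nonneg power2_eq_square)

lemma eip_scale_right: "eip d x (\<lambda>i. c * y i) = c * eip d x y"
  by (simp add: eip_def sum_distrib_left mult_ac)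

lemma eip_diff_right: "eip d x (\<lambda>i. y i - z i) = eip d x y - eip d x z"
  by (simp add: eip_def sum_subtractf algebra_simps)

lemma eip_diff_left: "eip d (\<lambda>i. y i - z i) x = eip d y x - eip d z x"
  by (simp add: eip_def sum_subtractf algebra_simps)

lemma eip_sum_right: "eip d x (\<lambda>i. \<Sum>s\<in>S. v s i) = (\<Sum>s\<in>S. eip d x (v s))"
  unfolding eip_def by (simp add: sum_distrib_left sum.swap[of _ "{..<d}" S])

lemma abs_eip_le: "\<bar>eip d x y\<bar> \<le> enorm d x * enorm d y"
proof -
  have "\<bar>eip d x y\<bar> \<le> (\<Sum>i<d. \<bar>x i * y i\<bar>)"
    unfolding eip_def by (rule sum_abs)
  also have "\<dots> \<le> enorm d x * enorm d y"
    using L2_set_mult_ineq[of x y "{..<d}"] by (simp add: abs_mult enorm_def)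
  finally show ?thesis .
qed

lemma eip_le: "eip d x y \<le> enorm d x * enorm d y"
  using abs_eip_le[of d x y] by linarith

lemma enorm_scale: "enorm d (\<lambda>i. c * x i) = \<bar>c\<bar> * enorm d x"
  unfolding enorm_def L2_set_def
  by (simp add: power_mult_distrib real_sqrt_mult flip: sum_distrib_left)

lemma enorm_add: "enorm d (\<lambda>i. x i + y i) \<le> enorm d x + enorm d y"
  unfolding enorm_def by (rule L2_set_triangle_ineq)

lemma enorm_diff: "enorm d (\<lambda>i. x i - y i) \<le> enorm d x + enorm d y"
  using enorm_add[of d x "\<lambda>i. - 1 * y i"] enorm_scale[of d "-1" y] by simp

lemma enorm_zero [simp]: "enorm d (\<lambda>i. 0) = 0"
  by (simp add: enorm_def L2_set_def)

lemma enorm_sum: "enorm d (\<lambda>i. \<Sum>s\<in>S. v s i) \<le> (\<Sum>s\<in>S. enorm d (v s))"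
proof (induction S rule: infinite_finite_induct)
  case (insert s S)
  have "enorm d (\<lambda>i. v s i + (\<Sum>s\<in>S. v s i)) \<le> enorm d (v s) + enorm d (\<lambda>i. \<Sum>s\<in>S. v s i)"
    by (rule enorm_add)
  with insert show ?case by simp
qed auto

lemma enorm_minus_commute: "enorm d (\<lambda>i. x i - y i) = enorm d (\<lambda>i. y i - x i)"
  using enorm_scale[of d "-1" "\<lambda>i. x i - y i"] by simp

lemma enorm_diff_triangle:
  "enorm d (\<lambda>i. x i - z i) \<le> enorm d (\<lambda>i. x i - y i) + enorm d (\<lambda>i. y i - z i)"
  using enorm_add[of d "\<lambda>i. x i - y i" "\<lambda>i. y i - z i"] by simp

lemma abs_component_le_enorm: "j < d \<Longrightarrow> \<bar>x j\<bar> \<le> enorm d x"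
  unfolding enorm_def L2_set_def
  by (rule order.trans[OF _ real_sqrt_le_mono[OF member_le_sum[of j]]]) auto

lemma enorm_add_power2: "(enorm d (\<lambda>i. x i + y i))\<^sup>2 = (enorm d x)\<^sup>2 + 2 * eip d x y + (enorm d y)\<^sup>2"
  unfolding enorm_power2 eip_def by (simp add: algebra_simps sum.distrib sum_distrib_left)

section \<open>Sampling without replacement\<close>

text \<open>Separates the linear term of \<open>exp z\<close>, so that for centred increments it
  cancels in the sum and only \<open>exp (z\<^sup>2)\<close> remains. For \<open>z\<close> up to 1
  the second-order bound \<open>1 + z + z\<^sup>2\<close> suffices; beyond 1, \<open>z\<close> is
  below its square.\<close>

lemma exp_le_add_exp_square: "exp z \<le> z + exp (z\<^sup>2)" for z :: real
proof (cases "z \<le> 1")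
  case True
  have "exp z \<le> 1 + z + z\<^sup>2"
  proof (cases "0 \<le> z")
    case True
    with \<open>z \<le> 1\<close> show ?thesis by (simp add: exp_bound)
  next
    case False
    have "exp z * (1 - z) \<le> exp z * exp (- z)"
      using exp_ge_add_one_self[of "- z"] by (intro mult_left_mono) auto
    then have "exp z * (1 - z) \<le> 1" by (simp add: exp_minus)
    also have "1 \<le> (1 + z + z\<^sup>2) * (1 - z)"
    proof -
      have "z * (z * z) \<le> 0" using False by (intro mult_nonpos_nonneg) auto
      then show ?thesis by (simp add: algebra_simps power2_eq_square)
    qed
    finally show ?thesis using False by simp
  qed
  also have "\<dots> \<le> z + exp (z\<^sup>2)"
    using exp_ge_add_one_self[of "z\<^sup>2"] by linarith
  finally show ?thesis .
next
  case False
  then have "z \<le> z\<^sup>2" by (simp add: power2_eq_square)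
  then have "exp z \<le> exp (z\<^sup>2)" by simp
  with False show ?thesis by linarith
qed

text \<open>
  A smooth surrogate for \<open>exp (\<lambda> \<parallel>x\<parallel>)\<close>. It grows by at most a constant factor
  when its argument is perturbed by centred bounded noise, in any dimension.
\<close>

definition norm_potential :: "nat \<Rightarrow> real \<Rightarrow> vec \<Rightarrow> real" where
  "norm_potential d l x = exp (sqrt (1 + l\<^sup>2 * (enorm d x)\<^sup>2))"

text \<open>The square root is replaced by its tangent at \<open>r\<^sup>2\<close>. The first-order
  part \<open>z s\<close> is linear in \<open>\<xi> s\<close> and sums to 0; what is left involves
  only norms, so the dimension does not appear.\<close>

lemma norm_potential_centred_step:
  fixes B :: real
  assumes S: "finite S" and B: "\<And>s. s \<in> S \<Longrightarrow> enorm d (\<xi> s) \<le> B"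
    and centred: "\<And>i. i < d \<Longrightarrow> (\<Sum>s\<in>S. \<xi> s i) = 0"
  shows "(\<Sum>s\<in>S. norm_potential d l (\<lambda>i. x i + \<xi> s i))
    \<le> card S * norm_potential d l x * exp (3 / 2 * l\<^sup>2 * B\<^sup>2)"
proof -
  define r where "r = sqrt (1 + l\<^sup>2 * (enorm d x)\<^sup>2)"
  have r1: "1 \<le> r" unfolding r_def by simp
  have r2: "r\<^sup>2 = 1 + l\<^sup>2 * (enorm d x)\<^sup>2" unfolding r_def by simp
  define z where "z = (\<lambda>s. l\<^sup>2 * eip d x (\<xi> s) / r)"
  have sumz: "(\<Sum>s\<in>S. z s) = 0"
  proof -
    have "(\<Sum>s\<in>S. eip d x (\<xi> s)) = eip d x (\<lambda>i. \<Sum>s\<in>S. \<xi> s i)"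
      by (simp add: eip_sum_right)
    also have "\<dots> = 0" unfolding eip_def using centred by simp
    finally show ?thesis by (simp add: z_def flip: sum_distrib_left sum_divide_distrib)
  qed
  have step: "norm_potential d l (\<lambda>i. x i + \<xi> s i)
      \<le> exp (r + l\<^sup>2 * B\<^sup>2 / 2) * (z s + exp (l\<^sup>2 * B\<^sup>2))" if s: "s \<in> S" for s
  proof -
    have \<xi>2: "(enorm d (\<xi> s))\<^sup>2 \<le> B\<^sup>2" using B[OF s] by (intro power_mono) auto
    have zB: "(z s)\<^sup>2 \<le> l\<^sup>2 * B\<^sup>2"
    proof -
      have lx: "l\<^sup>2 * (enorm d x)\<^sup>2 \<le> r\<^sup>2" using r2 by simp
      have "\<bar>eip d x (\<xi> s)\<bar> \<le> enorm d x * B"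
        using abs_eip_le[of d x "\<xi> s"] B[OF s] mult_left_mono[OF B[OF s], of "enorm d x"] by simp
      then have "(eip d x (\<xi> s))\<^sup>2 \<le> (enorm d x * B)\<^sup>2"
        by (metis abs_ge_zero power2_abs power_mono)
      then have "l\<^sup>2 * (l\<^sup>2 * (eip d x (\<xi> s))\<^sup>2) \<le> l\<^sup>2 * (l\<^sup>2 * (enorm d x * B)\<^sup>2)"
        by (intro mult_left_mono) auto
      also have "\<dots> = l\<^sup>2 * B\<^sup>2 * (l\<^sup>2 * (enorm d x)\<^sup>2)" by (simp add: power_mult_distrib)
      also have "\<dots> \<le> l\<^sup>2 * B\<^sup>2 * r\<^sup>2" using lx by (intro mult_left_mono) auto
      finally have "l\<^sup>2 * (l\<^sup>2 * (eip d x (\<xi> s))\<^sup>2) \<le> l\<^sup>2 * B\<^sup>2 * r\<^sup>2" .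
      then show ?thesis using r1
        by (simp add: z_def power_divide power_mult_distrib divide_le_eq mult_ac power2_eq_square)
    qed
    define y where "y = 1 + l\<^sup>2 * (enorm d (\<lambda>i. x i + \<xi> s i))\<^sup>2"
    have y0: "0 \<le> y" by (simp add: y_def)
    \<comment> \<open>Tangent bound for the square root, in the form of the inequality of arithmetic
      and geometric means.\<close>
    have "2 * sqrt y * r \<le> y + r\<^sup>2"
      using sum_squares_bound[of "sqrt y" r] y0 by simp
    then have "sqrt y \<le> (y + r\<^sup>2) / (2 * r)" using r1 by (simp add: le_divide_eq mult_ac)
    also have "\<dots> = r + (y - r\<^sup>2) / (2 * r)" using r1 by (simp add: field_simps power2_eq_square)
    also have "(y - r\<^sup>2) / (2 * r) = z s + l\<^sup>2 * (enorm d (\<xi> s))\<^sup>2 / (2 * r)"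
      using r1 by (simp add: y_def r2 z_def enorm_add_power2 field_simps)
    also have "l\<^sup>2 * (enorm d (\<xi> s))\<^sup>2 / (2 * r) \<le> l\<^sup>2 * B\<^sup>2 / 2"
      using r1 \<xi>2 by (intro frac_le mult_left_mono) auto
    finally have "sqrt y \<le> (r + l\<^sup>2 * B\<^sup>2 / 2) + z s" by linarith
    then have "norm_potential d l (\<lambda>i. x i + \<xi> s i) \<le> exp (r + l\<^sup>2 * B\<^sup>2 / 2) * exp (z s)"
      by (simp add: norm_potential_def y_def exp_add[symmetric])
    also have "exp (z s) \<le> z s + exp (l\<^sup>2 * B\<^sup>2)"
      using exp_le_add_exp_square[of "z s"] zB by (smt (verit) exp_le_cancel_iff)
    finally show ?thesis by simp
  qed
  have "(\<Sum>s\<in>S. norm_potential d l (\<lambda>i. x i + \<xi> s i))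
      \<le> (\<Sum>s\<in>S. exp (r + l\<^sup>2 * B\<^sup>2 / 2) * (z s + exp (l\<^sup>2 * B\<^sup>2)))"
    by (rule sum_mono) (rule step)
  also have "\<dots> = exp (r + l\<^sup>2 * B\<^sup>2 / 2) * (card S * exp (l\<^sup>2 * B\<^sup>2))"
    by (simp add: sum.distrib sumz flip: sum_distrib_left)
  \<comment> \<open>Of the factor 3 / 2, one half comes from the quadratic term under the root and 1
    from \<open>exp_le_add_exp_square\<close>.\<close>
  also have "\<dots> = card S * exp r * exp (l\<^sup>2 * B\<^sup>2 / 2 + l\<^sup>2 * B\<^sup>2)"
    by (simp only: exp_add mult_ac)
  also have "l\<^sup>2 * B\<^sup>2 / 2 + l\<^sup>2 * B\<^sup>2 = 3 / 2 * l\<^sup>2 * B\<^sup>2" by simp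
  finally show ?thesis by (simp add: norm_potential_def r_def)
qed

lemma enorm_diff_mean_le:
  fixes G :: real
  assumes S: "finite S" "s \<in> S" and G: "\<And>t. t \<in> S \<Longrightarrow> enorm d (v t) \<le> G"
  shows "enorm d (\<lambda>i. v s i - (\<Sum>t\<in>S. v t i) / card S) \<le> 2 * G"
proof -
  have c: "0 < real (card S)" using S by (metis card_gt_0_iff empty_iff of_nat_0_less_iff)
  have "enorm d (\<lambda>i. (1 / card S) * (\<Sum>t\<in>S. v t i)) \<le> 1 / card S * (\<Sum>t\<in>S. enorm d (v t))"
    using enorm_sum[of d v S] c by (simp only: enorm_scale) (simp add: divide_right_mono)
  also have "\<dots> \<le> 1 / card S * (\<Sum>t\<in>S. G)"
    using c G by (intro mult_left_mono sum_mono) auto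
  also have "\<dots> = G" using c by simp
  finally have "enorm d (\<lambda>i. (\<Sum>t\<in>S. v t i) / card S) \<le> G" by simp
  with enorm_diff[of d "v s" "\<lambda>i. (\<Sum>t\<in>S. v t i) / card S"] G[OF S(2)] show ?thesis by simp
qed

text \<open>
  The conditional means of \<open>w + \<Sum>j\<in>T. v (p j)\<close> given the first few values of \<open>p\<close> form a martingale.
  Drawing \<open>v b\<close> first moves the conditional mean by a multiple \<open>\<theta> \<in> [0, 1]\<close> of
  \<open>v b\<close> minus the average.
\<close>

lemma permutation_sum_norm_potential:
  fixes G :: real
  assumes T: "finite T" and S: "finite S" "T \<subseteq> S"
    and G: "\<And>s. s \<in> S \<Longrightarrow> enorm d (v s) \<le> G"
  shows "(\<Sum>p | p permutes S. norm_potential d l (\<lambda>i. w i + (\<Sum>j\<in>T. v (p j) i)))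
    \<le> fact (card S) * norm_potential d l (\<lambda>i. w i + card T * ((\<Sum>s\<in>S. v s i) / card S))
        * exp (6 * real (card T) * l\<^sup>2 * G\<^sup>2)"
  using T S G
proof (induction T arbitrary: S v w rule: finite_induct)
  case empty
  then show ?case by (simp add: card_permutations)
next
  case (insert a T)
  define R where "R = S - {a}"
  define N where "N = card S"
  define m where "m = card T"
  define V where "V = (\<lambda>i. (\<Sum>s\<in>S. v s i) / N)"
  have SR: "S = insert a R" "a \<notin> R" "finite R" "T \<subseteq> R"
    using insert.prems insert.hyps by (auto simp: R_def)
  have cR: "real (card R) = real N - 1" "N = Suc (card R)"
    using SR by (auto simp: N_def)
  have mR: "m \<le> card R" unfolding m_def using SR by (intro card_mono) auto
  \<comment> \<open>After \<open>b\<close> is drawn, each of the \<open>m\<close> further draws has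
    mean \<open>(N * V i - v b i) / card R\<close>, so \<open>v b\<close> keeps the weight
    \<open>1 - m / card R\<close> in the conditional mean. If \<open>R\<close> is empty, then
    \<open>m = 0\<close> and the division by zero gives the right value 1.\<close>
  define \<theta> where "\<theta> = 1 - m / card R"
  have \<theta>: "0 \<le> \<theta>" "\<theta> \<le> 1" using mR by (auto simp: \<theta>_def divide_le_eq_1)
  \<comment> \<open>A permutation of \<open>S\<close> with value \<open>b\<close> at
    \<open>a\<close> is a permutation \<open>q\<close> of \<open>R\<close> followed by the
    transposition of \<open>a\<close> and \<open>b\<close>. Relabelling \<open>v\<close> along the
    transposition makes the remaining draws a sample from \<open>R\<close>, and \<open>v b\<close>
    joins the offset \<open>w\<close>.\<close>
  have inner: "(\<Sum>q | q permutes R. norm_potential d l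
        (\<lambda>i. w i + (\<Sum>j\<in>insert a T. v ((Transposition.transpose a b \<circ> q) j) i)))
      \<le> fact (card R) * exp (6 * real m * l\<^sup>2 * G\<^sup>2)
        * norm_potential d l (\<lambda>i. (w i + (m + 1) * V i) + \<theta> * (v b i - V i))"
    if b: "b \<in> S" for b
  proof -
    define v' where "v' = (\<lambda>s. v (Transposition.transpose a b s))"
    have "(\<Sum>q | q permutes R. norm_potential d l
        (\<lambda>i. w i + (\<Sum>j\<in>insert a T. v ((Transposition.transpose a b \<circ> q) j) i)))
      = (\<Sum>q | q permutes R. norm_potential d l
        (\<lambda>i. (w i + v b i) + (\<Sum>j\<in>T. v' (q j) i)))"
    proof (rule sum.cong[OF refl])
      fix q assume "q \<in> {q. q permutes R}"
      then have "q a = a" using SR by (auto simp: permutes_not_in)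
      then show "norm_potential d l (\<lambda>i. w i + (\<Sum>j\<in>insert a T. v ((Transposition.transpose a b \<circ> q) j) i))
        = norm_potential d l (\<lambda>i. (w i + v b i) + (\<Sum>j\<in>T. v' (q j) i))"
        using insert.hyps by (simp add: v'_def add.assoc)
    qed
    also have "\<dots> \<le> fact (card R)
        * norm_potential d l (\<lambda>i. (w i + v b i) + m * ((\<Sum>s\<in>R. v' s i) / card R))
        * exp (6 * real m * l\<^sup>2 * G\<^sup>2)"
      unfolding m_def
    proof (rule insert.IH)
      fix s assume "s \<in> R"
      then have "Transposition.transpose a b s \<in> S" using b SR by (auto simp: Transposition.transpose_def)
      then show "enorm d (v' s) \<le> G" unfolding v'_def by (rule insert.prems)
    qed (use SR in auto)
    also have "(\<lambda>i. (w i + v b i) + m * ((\<Sum>s\<in>R. v' s i) / card R))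
        = (\<lambda>i. (w i + (m + 1) * V i) + \<theta> * (v b i - V i))"
    proof
      fix i
      have "(\<Sum>s\<in>S. v s i) = (\<Sum>s\<in>S. v' s i)"
        unfolding v'_def
        by (rule sum.permute[of "Transposition.transpose a b" S "\<lambda>s. v s i", unfolded o_def])
          (use b SR in \<open>auto intro: permutes_swap_id\<close>)
      also have "\<dots> = v b i + (\<Sum>s\<in>R. v' s i)"
        using SR by (simp add: v'_def)
      finally have e: "(\<Sum>s\<in>R. v' s i) = N * V i - v b i"
        using cR by (simp add: V_def)
      show "(w i + v b i) + m * ((\<Sum>s\<in>R. v' s i) / card R)
          = (w i + (m + 1) * V i) + \<theta> * (v b i - V i)"
      proof (cases "card R = 0")
        case True
        then have "m = 0" using mR by simp
        with True show ?thesis by (simp add: \<theta>_def)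
      next
        case False
        show ?thesis unfolding e \<theta>_def using False cR(2)
          by (simp add: field_simps)
      qed
    qed
    finally show ?thesis by (simp add: mult_ac)
  qed
  have "(\<Sum>p | p permutes S. norm_potential d l (\<lambda>i. w i + (\<Sum>j\<in>insert a T. v (p j) i)))
      = (\<Sum>b\<in>S. \<Sum>q | q permutes R. norm_potential d l
        (\<lambda>i. w i + (\<Sum>j\<in>insert a T. v ((Transposition.transpose a b \<circ> q) j) i)))"
    unfolding SR(1) by (rule sum_over_permutations_insert) (use SR in auto)
  also have "\<dots> \<le> (\<Sum>b\<in>S. fact (card R) * exp (6 * real m * l\<^sup>2 * G\<^sup>2)
        * norm_potential d l (\<lambda>i. (w i + (m + 1) * V i) + \<theta> * (v b i - V i)))"
    by (rule sum_mono) (rule inner)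
  also have "\<dots> = fact (card R) * exp (6 * real m * l\<^sup>2 * G\<^sup>2)
        * (\<Sum>b\<in>S. norm_potential d l (\<lambda>i. (w i + (m + 1) * V i) + \<theta> * (v b i - V i)))"
    by (simp add: sum_distrib_left)
  \<comment> \<open>One centred step with increments of norm at most \<open>2 * G\<close>; its cost
    \<open>3 / 2 * (2 * G)\<^sup>2 = 6 * G\<^sup>2\<close> is the contribution of the additional
    draw to the exponent.\<close>
  also have "\<dots> \<le> fact (card R) * exp (6 * real m * l\<^sup>2 * G\<^sup>2)
        * (card S * norm_potential d l (\<lambda>i. w i + (m + 1) * V i) * exp (3 / 2 * l\<^sup>2 * (2 * G)\<^sup>2))"
  proof (intro mult_left_mono norm_potential_centred_step)
    fix b assume b: "b \<in> S"
    have "enorm d (\<lambda>i. v b i - V i) \<le> 2 * G"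
      unfolding V_def N_def by (rule enorm_diff_mean_le) (use insert.prems b in auto)
    moreover have "\<theta> * enorm d (\<lambda>i. v b i - V i) \<le> 1 * enorm d (\<lambda>i. v b i - V i)"
      using \<theta> by (intro mult_right_mono) auto
    ultimately show "enorm d (\<lambda>i. \<theta> * (v b i - V i)) \<le> 2 * G"
      using \<theta> by (simp only: enorm_scale)
  next
    fix i
    have "(\<Sum>s\<in>S. v s i - V i) = 0"
      using cR(2) by (simp add: V_def sum_subtractf N_def[symmetric])
    then show "(\<Sum>s\<in>S. \<theta> * (v s i - V i)) = 0" by (simp flip: sum_distrib_left)
  qed (use insert.prems in auto)
  also have "\<dots> = fact N * norm_potential d l (\<lambda>i. w i + (m + 1) * V i)
       * exp (6 * real m * l\<^sup>2 * G\<^sup>2 + 3 / 2 * l\<^sup>2 * (2 * G)\<^sup>2)"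
    using cR(2) by (simp add: exp_add[symmetric] N_def[symmetric] mult.assoc)
  also have "6 * real m * l\<^sup>2 * G\<^sup>2 + 3 / 2 * l\<^sup>2 * (2 * G)\<^sup>2 = 6 * (real m + 1) * l\<^sup>2 * G\<^sup>2"
    by (simp add: algebra_simps power_mult_distrib)
  finally show ?case using insert.hyps by (simp add: m_def V_def N_def add.commute)
qed


text \<open>Markov's inequality for the exponential potential, followed by optimisation over its
  parameter \<open>l\<close>.\<close>

lemma permutation_deviation_tail:
  fixes G t :: real
  assumes S: "finite S" "S \<noteq> {}" "T \<subseteq> S"
    and G: "\<And>s. s \<in> S \<Longrightarrow> enorm d (v s) \<le> G" and "0 < G" and t: "0 \<le> t"
  shows "measure_pmf.prob (pmf_of_set {p. p permutes S})
      {p. t < enorm d (\<lambda>i. (\<Sum>j\<in>T. v (p j) i) - card T * ((\<Sum>s\<in>S. v s i) / card S))}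
    \<le> exp (1 - t\<^sup>2 / (24 * real (card S) * G\<^sup>2))"
proof -
  define P where "P = {p. p permutes S}"
  define N where "N = real (card S)"
  define m where "m = real (card T)"
  define dev where "dev = (\<lambda>p i. - (m * ((\<Sum>s\<in>S. v s i) / N)) + (\<Sum>j\<in>T. v (p j) i))"
  define A where "A = {p. t < enorm d (dev p)}"
  \<comment> \<open>The minimizer of the exponent
    \<open>6 * N * l\<^sup>2 * G\<^sup>2 - l * t\<close>.\<close>
  define l where "l = t / (12 * N * G\<^sup>2)"
  have N: "0 < N" using S by (simp add: N_def card_gt_0_iff)
  have mN: "0 \<le> m" "m \<le> N" using S by (auto simp: m_def N_def card_mono)
  have l0: "0 \<le> l" using N t by (simp add: l_def)
  have P: "finite P" "P \<noteq> {}" "real (card P) = fact (card S)"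
    using S by (auto simp: P_def finite_permutations card_permutations intro: permutes_id)
  have "card (P \<inter> A) * exp (l * t) = (\<Sum>p\<in>P \<inter> A. exp (l * t))" by simp
  also have "\<dots> \<le> (\<Sum>p\<in>P \<inter> A. norm_potential d l (dev p))"
  proof (rule sum_mono)
    fix p assume "p \<in> P \<inter> A"
    then have "l * t \<le> l * enorm d (dev p)" using l0 by (intro mult_left_mono) (auto simp: A_def)
    also have "\<dots> \<le> sqrt (1 + l\<^sup>2 * (enorm d (dev p))\<^sup>2)"
      by (rule real_le_rsqrt) (simp add: power_mult_distrib)
    finally show "exp (l * t) \<le> norm_potential d l (dev p)" by (simp add: norm_potential_def)
  qed
  also have "\<dots> \<le> (\<Sum>p\<in>P. norm_potential d l (dev p))"
    by (rule sum_mono2) (use P in \<open>auto simp: norm_potential_def\<close>)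
  \<comment> \<open>The offset is minus the mean of the sum, so the potential on the right is taken
    at the zero vector, where it equals \<open>exp 1\<close>. This is the 1 in the exponent of the
    tail.\<close>
  also have "\<dots> \<le> fact (card S) * norm_potential d l
        (\<lambda>i. - (m * ((\<Sum>s\<in>S. v s i) / N)) + card T * ((\<Sum>s\<in>S. v s i) / card S))
      * exp (6 * real (card T) * l\<^sup>2 * G\<^sup>2)"
    unfolding P_def dev_def
    by (rule permutation_sum_norm_potential) (use S G in \<open>auto intro: finite_subset\<close>)
  also have "\<dots> = card P * (exp 1 * exp (6 * m * l\<^sup>2 * G\<^sup>2))"
    by (simp add: m_def N_def P norm_potential_def)
  also have "\<dots> \<le> card P * (exp 1 * exp (6 * N * l\<^sup>2 * G\<^sup>2))"
    using mN by (intro mult_left_mono exp_mono mult_right_mono) auto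
  finally have "card (P \<inter> A) / card P * exp (l * t) \<le> exp 1 * exp (6 * N * l\<^sup>2 * G\<^sup>2)"
    using P by (simp add: divide_le_eq mult_ac card_gt_0_iff)
  then have "card (P \<inter> A) / card P \<le> exp 1 * exp (6 * N * l\<^sup>2 * G\<^sup>2) / exp (l * t)"
    by (simp add: le_divide_eq)
  also have "\<dots> = exp (1 + (6 * N * l\<^sup>2 * G\<^sup>2 - l * t))"
    by (simp add: exp_add exp_diff)
  also have "6 * N * l\<^sup>2 * G\<^sup>2 - l * t = - (t\<^sup>2 / (24 * N * G\<^sup>2))"
    using N \<open>0 < G\<close> by (simp add: l_def field_simps power2_eq_square)
  finally have "measure_pmf.prob (pmf_of_set P) A \<le> exp (1 - t\<^sup>2 / (24 * N * G\<^sup>2))"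
    using P by (simp add: measure_pmf_of_set)
  then show ?thesis by (simp add: A_def P_def N_def dev_def m_def)
qed

section \<open>Smooth functions\<close>

lemma has_gradient_sum:
  assumes "\<And>s. s \<in> S \<Longrightarrow> has_gradient d (h s) (g s) x"
  shows "has_gradient d (\<lambda>y. \<Sum>s\<in>S. h s y) (\<lambda>j. \<Sum>s\<in>S. g s j) x"
  unfolding has_gradient_def
proof
  show "(\<lambda>j. \<Sum>s\<in>S. g s j) \<in> Rd d"
    using assms by (auto simp: has_gradient_def mem_Rd_iff)
  have "((\<lambda>y. \<Sum>s\<in>S. (h s y - h s x - (\<Sum>i<d. g s i * (y i - x i))) / enorm d (\<lambda>i. y i - x i))
      \<longlongrightarrow> (\<Sum>s\<in>S. 0)) (at x within Rd d)"
    using assms by (intro tendsto_sum) (simp add: has_gradient_def)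
  moreover have "(\<Sum>s\<in>S. (h s y - h s x - (\<Sum>i<d. g s i * (y i - x i))) / enorm d (\<lambda>i. y i - x i))
      = ((\<Sum>s\<in>S. h s y) - (\<Sum>s\<in>S. h s x) - (\<Sum>i<d. (\<Sum>s\<in>S. g s i) * (y i - x i)))
        / enorm d (\<lambda>i. y i - x i)" for y
    by (simp add: sum_subtractf sum_distrib_right sum.swap[of _ "{..<d}" S] flip: sum_divide_distrib)
  ultimately show "((\<lambda>y. ((\<Sum>s\<in>S. h s y) - (\<Sum>s\<in>S. h s x)
      - (\<Sum>i<d. (\<Sum>s\<in>S. g s i) * (y i - x i))) / enorm d (\<lambda>i. y i - x i)) \<longlongrightarrow> 0) (at x within Rd d)"
    by simp
qed

lemma has_gradient_divide:
  assumes "has_gradient d h g x"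
  shows "has_gradient d (\<lambda>y. h y / c) (\<lambda>j. g j / c) x"
  unfolding has_gradient_def
proof
  show "(\<lambda>j. g j / c) \<in> Rd d"
    using assms by (auto simp: has_gradient_def mem_Rd_iff)
  have "((\<lambda>y. (h y - h x - (\<Sum>i<d. g i * (y i - x i))) / enorm d (\<lambda>i. y i - x i) / c)
      \<longlongrightarrow> 0 / c) (at x within Rd d)"
    using assms unfolding has_gradient_def by (intro tendsto_divide_zero[THEN tendsto_eq_rhs]) auto
  moreover have "(h y - h x - (\<Sum>i<d. g i * (y i - x i))) / enorm d (\<lambda>i. y i - x i) / c
      = (h y / c - h x / c - (\<Sum>i<d. g i / c * (y i - x i))) / enorm d (\<lambda>i. y i - x i)" for y
    by (simp add: diff_divide_distrib sum_divide_distrib divide_divide_eq_left mult.commute)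
  ultimately show "((\<lambda>y. (h y / c - h x / c - (\<Sum>i<d. g i / c * (y i - x i)))
      / enorm d (\<lambda>i. y i - x i)) \<longlongrightarrow> 0) (at x within Rd d)"
    by simp
qed

lemma has_gradient_grad:
  "differentiable_Rd d h \<Longrightarrow> x \<in> Rd d \<Longrightarrow> has_gradient d h (grad d h x) x"
  unfolding differentiable_Rd_def using grad_eqI by metis

lemma grad_in_Rd: "differentiable_Rd d h \<Longrightarrow> x \<in> Rd d \<Longrightarrow> grad d h x \<in> Rd d"
  using has_gradient_grad by (auto simp: has_gradient_def)

lemma has_gradient_avg:
  assumes "\<And>i. i \<in> {1..n} \<Longrightarrow> differentiable_Rd d (f i)" and "x \<in> Rd d"
  shows "has_gradient d (avg n f) (\<lambda>j. (\<Sum>i=1..n. grad d (f i) x j) / n) x"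
  unfolding avg_def[abs_def] using assms
  by (intro has_gradient_divide has_gradient_sum has_gradient_grad) auto

lemma grad_avg:
  assumes "\<And>i. i \<in> {1..n} \<Longrightarrow> differentiable_Rd d (f i)" and "x \<in> Rd d"
  shows "grad d (avg n f) x = (\<lambda>j. (\<Sum>i=1..n. grad d (f i) x j) / n)"
  using assms by (intro grad_eqI has_gradient_avg)

text \<open>The passage to one-variable calculus. A direction of norm 0 is treated apart: the path
  then never leaves the base point, which the limit in \<open>has_gradient\<close> excludes.\<close>

lemma has_gradient_imp_DERIV_line:
  assumes x: "x \<in> Rd d" and v: "v \<in> Rd d"
    and g: "has_gradient d h g (\<lambda>i. x i + t * v i)"
  shows "((\<lambda>t. h (\<lambda>i. x i + t * v i)) has_real_derivative eip d g v) (at t)"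
proof (cases "enorm d v = 0")
  case True
  then have "\<forall>i<d. v i = 0" by (auto simp: enorm_def L2_set_eq_0_iff)
  with v have "v = (\<lambda>i. 0)" by (auto simp: mem_Rd_iff fun_eq_iff not_le[symmetric])
  then show ?thesis by (simp add: eip_def)
next
  case False
  then have npos: "0 < enorm d v" by (simp add: less_le)
  define p where "p = (\<lambda>s::real. \<lambda>i. x i + (t + s) * v i)"
  let ?x = "\<lambda>i. x i + t * v i"
  have p0: "p 0 = ?x" by (simp add: p_def)
  have "continuous_on UNIV p"
    unfolding p_def
    by (intro continuous_on_coordinatewise_then_product continuous_intros)
  then have lim: "(p \<longlongrightarrow> ?x) (at 0)"
    unfolding p0[symmetric] by (simp add: continuous_on_def)
  have "\<forall>\<^sub>F s in at 0. p s \<in> Rd d \<and> p s \<noteq> ?x"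
    unfolding eventually_at_filter
  proof (intro always_eventually allI impI)
    fix s :: real assume "s \<noteq> 0"
    obtain j where "j < d" "v j \<noteq> 0" using False by (auto simp: enorm_def L2_set_eq_0_iff)
    then have "p s j \<noteq> ?x j" using \<open>s \<noteq> 0\<close> by (simp add: p_def)
    moreover have "p s \<in> Rd d" using x v by (auto simp: p_def mem_Rd_iff)
    ultimately show "p s \<in> Rd d \<and> p s \<noteq> ?x" by metis
  qed
  with lim have fl: "filterlim p (at ?x within Rd d) (at 0)"
    by (auto simp: filterlim_at)
  have "((\<lambda>s. (h (p s) - h ?x - (\<Sum>i<d. g i * (p s i - (x i + t * v i))))
      / enorm d (\<lambda>i. p s i - (x i + t * v i))) \<longlongrightarrow> 0) (at 0)"
    using g unfolding has_gradient_def by (intro filterlim_compose[OF _ fl]) auto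
  \<comment> \<open>The quotient in \<open>has_gradient\<close> has the denominator
    \<open>\<bar>s\<bar> * enorm d v\<close>. Multiplying by \<open>enorm d v\<close> and taking
    absolute values turns it into the error of the signed difference quotient.\<close>
  then have "((\<lambda>s. enorm d v * \<bar>(h (p s) - h ?x - (\<Sum>i<d. g i * (p s i - (x i + t * v i))))
      / enorm d (\<lambda>i. p s i - (x i + t * v i))\<bar>) \<longlongrightarrow> enorm d v * \<bar>0\<bar>) (at 0)"
    by (intro tendsto_intros)
  moreover have "enorm d v * \<bar>(h (p s) - h ?x - (\<Sum>i<d. g i * (p s i - (x i + t * v i))))
      / enorm d (\<lambda>i. p s i - (x i + t * v i))\<bar> = \<bar>(h (p s) - h ?x) / s - eip d g v\<bar>"
    if "s \<noteq> 0" for s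
  proof -
    have "(\<lambda>i. p s i - (x i + t * v i)) = (\<lambda>i. s * v i)"
      by (simp add: p_def algebra_simps)
    then have a: "enorm d (\<lambda>i. p s i - (x i + t * v i)) = \<bar>s\<bar> * enorm d v"
      by (simp add: enorm_scale)
    have b: "(\<Sum>i<d. g i * (p s i - (x i + t * v i))) = s * eip d g v"
      by (simp add: p_def algebra_simps eip_def sum_distrib_left)
    have "enorm d v * \<bar>(h (p s) - h ?x - s * eip d g v) / (\<bar>s\<bar> * enorm d v)\<bar>
        = \<bar>(h (p s) - h ?x - s * eip d g v) / s\<bar>"
      using npos by (simp add: abs_mult abs_divide)
    also have "(h (p s) - h ?x - s * eip d g v) / s = (h (p s) - h ?x) / s - eip d g v"
      using that by (simp add: field_simps)
    finally show ?thesis unfolding a b .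
  qed
  ultimately have "((\<lambda>s. \<bar>(h (p s) - h ?x) / s - eip d g v\<bar>) \<longlongrightarrow> 0) (at 0)"
    by (subst tendsto_cong[where g = "\<lambda>s. enorm d v * \<bar>(h (p s) - h ?x
        - (\<Sum>i<d. g i * (p s i - (x i + t * v i)))) / enorm d (\<lambda>i. p s i - (x i + t * v i))\<bar>"])
      (auto simp: eventually_at_filter)
  then have "((\<lambda>s. (h (p s) - h ?x) / s - eip d g v) \<longlongrightarrow> 0) (at 0)"
    by (simp add: tendsto_rabs_zero_iff)
  then show ?thesis
    by (simp add: DERIV_def p_def LIM_zero_iff)
qed

text \<open>Along the segment, \<open>h\<close> minus its linear part and the quadratic term has a
  nonpositive derivative, by Cauchy-Schwarz and the Lipschitz bound on the gradient.\<close>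

lemma smooth_descent:
  assumes h: "h \<in> smooth_class d L" and x: "x \<in> Rd d" and y: "y \<in> Rd d"
  shows "h y \<le> h x + eip d (grad d h x) (\<lambda>i. y i - x i)
      + L / 2 * (enorm d (\<lambda>i. y i - x i))\<^sup>2"
proof -
  define v where "v = (\<lambda>i. y i - x i)"
  have v: "v \<in> Rd d" using x y by (simp add: v_def mem_Rd_iff)
  define p where "p = (\<lambda>t::real. \<lambda>i. x i + t * v i)"
  have p: "p t \<in> Rd d" for t using x v by (simp add: p_def mem_Rd_iff)
  have dh: "differentiable_Rd d h" using h by (simp add: smooth_class_def)
  define \<phi> where "\<phi> = (\<lambda>t. h (p t) - t * eip d (grad d h x) v - L * t\<^sup>2 / 2 * (enorm d v)\<^sup>2)"
  have "\<phi> 1 \<le> \<phi> 0"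
  proof (rule DERIV_nonpos_imp_nonincreasing[of 0 1 \<phi>])
    fix t :: real assume t: "0 \<le> t" "t \<le> 1"
    let ?D = "eip d (grad d h (p t)) v - eip d (grad d h x) v - L * t * (enorm d v)\<^sup>2"
    have "((\<lambda>t. h (p t)) has_real_derivative eip d (grad d h (p t)) v) (at t)"
      unfolding p_def
      by (rule has_gradient_imp_DERIV_line[OF x v]) (use has_gradient_grad[OF dh p] in \<open>simp add: p_def\<close>)
    then have "(\<phi> has_real_derivative ?D) (at t)"
      unfolding \<phi>_def by (auto intro!: derivative_eq_intros)
    moreover have "?D \<le> 0"
    proof -
      have "eip d (grad d h (p t)) v - eip d (grad d h x) v
          \<le> enorm d (\<lambda>j. grad d h (p t) j - grad d h x j) * enorm d v"
        using eip_le[of d "\<lambda>j. grad d h (p t) j - grad d h x j" v] by (simp add: eip_diff_left)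
      also have "enorm d (\<lambda>j. grad d h (p t) j - grad d h x j) \<le> L * enorm d (\<lambda>j. p t j - x j)"
        using h p x by (simp add: smooth_class_def)
      also have "enorm d (\<lambda>j. p t j - x j) = t * enorm d v"
        using t by (simp add: p_def enorm_scale)
      finally show ?thesis by (simp add: power2_eq_square mult_ac mult_right_mono)
    qed
    ultimately show "\<exists>y. (\<phi> has_real_derivative y) (at t) \<and> y \<le> 0" by blast
  qed simp
  moreover have "p 1 = y" "p 0 = x" by (auto simp: p_def v_def)
  ultimately show ?thesis by (simp add: \<phi>_def v_def)
qed

lemma avg_smooth:
  assumes n: "0 < n" and f: "\<And>i. i \<in> {1..n} \<Longrightarrow> f i \<in> smooth_class d L"
  shows "avg n f \<in> smooth_class d L"
proof -
  have df: "differentiable_Rd d (f i)" if "i \<in> {1..n}" for i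
    using f[OF that] by (simp add: smooth_class_def)
  have "differentiable_Rd d (avg n f)"
    unfolding differentiable_Rd_def
  proof
    fix x assume "x \<in> Rd d"
    with df have "has_gradient d (avg n f) (\<lambda>j. (\<Sum>i=1..n. grad d (f i) x j) / n) x"
      by (intro has_gradient_avg)
    then show "\<exists>g. has_gradient d (avg n f) g x" by blast
  qed
  moreover have "enorm d (\<lambda>j. grad d (avg n f) x j - grad d (avg n f) y j)
      \<le> L * enorm d (\<lambda>j. x j - y j)" if xy: "x \<in> Rd d" "y \<in> Rd d" for x y
  proof -
    have "(\<lambda>j. grad d (avg n f) x j - grad d (avg n f) y j)
        = (\<lambda>j. (1 / n) * (\<Sum>i=1..n. grad d (f i) x j - grad d (f i) y j))"
      using grad_avg[OF df] xy by (simp add: sum_subtractf diff_divide_distrib)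
    then have "enorm d (\<lambda>j. grad d (avg n f) x j - grad d (avg n f) y j)
        = (1 / n) * enorm d (\<lambda>j. \<Sum>i=1..n. grad d (f i) x j - grad d (f i) y j)"
      by (simp only: enorm_scale) simp
    also have "\<dots> \<le> (1 / n) * (\<Sum>i=1..n. enorm d (\<lambda>j. grad d (f i) x j - grad d (f i) y j))"
      by (intro mult_left_mono enorm_sum) auto
    also have "\<dots> \<le> (1 / n) * (\<Sum>i=1..n. L * enorm d (\<lambda>j. x j - y j))"
      using f xy by (intro mult_left_mono sum_mono) (auto simp: smooth_class_def)
    also have "\<dots> = L * enorm d (\<lambda>j. x j - y j)" using n by simp
    finally show ?thesis .
  qed
  ultimately show ?thesis by (simp add: smooth_class_def)
qed

section \<open>Sublevel sets of Polyak-Lojasiewicz functions\<close>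

lemma minimizers_le: "minimizers d h \<noteq> {} \<Longrightarrow> x \<in> Rd d \<Longrightarrow> min_value d h \<le> h x"
  using min_value_eq by (fastforce simp: minimizers_def)

lemma gradient_step_decrease:
  assumes h: "h \<in> smooth_class d L" and L: "0 < L" and x: "x \<in> Rd d"
  defines "y \<equiv> \<lambda>i. x i - grad d h x i / L"
  shows "y \<in> Rd d" and "h y \<le> h x - (enorm d (grad d h x))\<^sup>2 / (2 * L)"
    and "enorm d (\<lambda>i. y i - x i) = enorm d (grad d h x) / L"
proof -
  have g: "grad d h x \<in> Rd d" using h x by (intro grad_in_Rd) (auto simp: smooth_class_def)
  show y: "y \<in> Rd d" using x g by (simp add: y_def mem_Rd_iff)
  have e: "(\<lambda>i. y i - x i) = (\<lambda>i. (- 1 / L) * grad d h x i)" by (simp add: y_def)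
  show n: "enorm d (\<lambda>i. y i - x i) = enorm d (grad d h x) / L"
    using L unfolding e by (simp only: enorm_scale) simp
  have "eip d (grad d h x) (\<lambda>i. y i - x i) = - (enorm d (grad d h x))\<^sup>2 / L"
    unfolding e by (simp only: eip_scale_right enorm_power2) simp
  with smooth_descent[OF h x y] L show "h y \<le> h x - (enorm d (grad d h x))\<^sup>2 / (2 * L)"
    by (simp add: n power_divide field_simps power2_eq_square)
qed

text \<open>A gradient step of size \<open>1 / L\<close> gains
  \<open>(enorm d (grad d h x))\<^sup>2 / (2 * L)\<close>, and it cannot gain more than the gap to
  the minimum.\<close>

lemma enorm_grad_le:
  assumes h: "h \<in> smooth_class d L" and L: "0 < L" and x: "x \<in> Rd d" and m: "minimizers d h \<noteq> {}"
  shows "enorm d (grad d h x) \<le> sqrt (2 * L * (h x - min_value d h))"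
proof (rule real_le_rsqrt)
  have "min_value d h \<le> h x - (enorm d (grad d h x))\<^sup>2 / (2 * L)"
    using minimizers_le[OF m gradient_step_decrease(1)[OF h L x]] gradient_step_decrease(2)[OF h L x]
    by linarith
  with L show "(enorm d (grad d h x))\<^sup>2 \<le> 2 * L * (h x - min_value d h)"
    by (simp add: field_simps)
qed

text \<open>
  Gradient descent from \<open>x\<close> with step size \<open>1 / L\<close> has a length of at most the right-hand side,
  by linear convergence, and ends in a minimizer.
\<close>

lemma pl_dist_minimizer:
  assumes h: "h \<in> smooth_class d L" and L: "0 < L" and \<mu>: "0 < \<mu>"
    and pl: "polyak_lojasiewicz d \<mu> h" and x: "x \<in> Rd d"
  shows "\<exists>z\<in>minimizers d h. enorm d (\<lambda>i. x i - z i)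
    \<le> sqrt (2 * L * (h x - min_value d h)) / (L * (1 - exp (- \<mu> / (2 * L))))"
proof -
  have m: "minimizers d h \<noteq> {}" using pl by (simp add: polyak_lojasiewicz_def)
  define u where "u = (\<lambda>t. ((\<lambda>x i. x i - grad d h x i / L) ^^ t) x)"
  define \<Delta> where "\<Delta> = h x - min_value d h"
  \<comment> \<open>The gap contracts by \<open>1 - \<mu> / L\<close>, hence by
    \<open>exp (- \<mu> / L) = q\<^sup>2\<close>; step lengths scale with the root of the gap and so
    contract by \<open>q\<close>. The exponential form gives \<open>0 < q\<close> and
    \<open>q < 1\<close> without comparing \<open>\<mu>\<close> with \<open>L\<close>.\<close>
  define q where "q = exp (- \<mu> / (2 * L))"
  define c where "c = sqrt (2 * L * \<Delta>) / L"
  have u0: "u 0 = x" and uS: "u (Suc t) = (\<lambda>i. u t i - grad d h (u t) i / L)" for t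
    by (auto simp: u_def)
  have u: "u t \<in> Rd d" for t
    by (induction t) (auto simp: u0 x uS intro: gradient_step_decrease(1)[OF h L])
  have q: "0 < q" "q < 1" using L \<mu> by (auto simp: q_def)
  have q2: "q\<^sup>2 = exp (- \<mu> / L)" by (simp add: q_def power2_eq_square flip: exp_add)
  have ge: "min_value d h \<le> h (u t)" for t using minimizers_le[OF m u] .
  have gap: "h (u t) - min_value d h \<le> \<Delta> * (q ^ t)\<^sup>2" for t
  proof (induction t)
    case 0
    then show ?case by (simp add: u0 \<Delta>_def)
  next
    case (Suc t)
    have "\<mu> * (h (u t) - min_value d h) \<le> 1 / 2 * (enorm d (grad d h (u t)))\<^sup>2"
      using pl u by (simp add: polyak_lojasiewicz_def)
    moreover have "h (u (Suc t)) \<le> h (u t) - (enorm d (grad d h (u t)))\<^sup>2 / (2 * L)"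
      unfolding uS by (rule gradient_step_decrease(2)[OF h L u])
    ultimately have "h (u (Suc t)) - min_value d h \<le> (1 + - \<mu> / L) * (h (u t) - min_value d h)"
      using L by (simp add: field_simps)
    also have "\<dots> \<le> q\<^sup>2 * (h (u t) - min_value d h)"
      unfolding q2 using ge[of t] by (intro mult_right_mono exp_ge_add_one_self) auto
    also have "\<dots> \<le> q\<^sup>2 * (\<Delta> * (q ^ t)\<^sup>2)"
      using Suc by (intro mult_left_mono) auto
    finally show ?case by (simp add: power_mult_distrib mult_ac)
  qed
  have \<Delta>: "0 \<le> \<Delta>" using ge[of 0] by (simp add: \<Delta>_def u0)
  have c0: "0 \<le> c" using L \<Delta> by (simp add: c_def)
  have gr: "enorm d (grad d h (u t)) / L \<le> c * q ^ t" for t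
  proof -
    have "enorm d (grad d h (u t)) \<le> sqrt (2 * L * (h (u t) - min_value d h))"
      by (rule enorm_grad_le[OF h L u m])
    also have "\<dots> \<le> sqrt (2 * L * (\<Delta> * (q ^ t)\<^sup>2))"
      using gap[of t] L by (intro real_sqrt_le_mono mult_left_mono) auto
    also have "\<dots> = sqrt (2 * L * \<Delta>) * q ^ t"
      using q by (simp add: real_sqrt_mult mult.assoc)
    finally show ?thesis using L by (simp add: c_def divide_right_mono)
  qed
  have step: "enorm d (\<lambda>i. u (Suc t) i - u t i) \<le> c * q ^ t" for t
    unfolding uS gradient_step_decrease(3)[OF h L u] by (rule gr)
  have path: "enorm d (\<lambda>i. x i - u t i) \<le> c / (1 - q)" for t
  proof -
    have "enorm d (\<lambda>i. u t i - x i) \<le> c * (\<Sum>s<t. q ^ s)"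
    proof (induction t)
      case 0
      then show ?case by (simp add: u0)
    next
      case (Suc t)
      with enorm_diff_triangle[of d "u (Suc t)" x "u t"] step[of t] show ?case
        by (simp add: algebra_simps)
    qed
    also have "\<dots> \<le> c * (1 / (1 - q))"
      using q c0 by (intro mult_left_mono)
        (auto simp: sum_gp_strict divide_right_mono)
    finally show ?thesis by (simp add: enorm_minus_commute)
  qed
  \<comment> \<open>The increments are dominated by a geometric series, so each coordinate
    converges; the limits are assembled into \<open>z\<close>.\<close>
  have "\<exists>l. (\<lambda>t. u t j) \<longlonglongrightarrow> l" for j
  proof (cases "j < d")
    case True
    have "summable (\<lambda>t. u (Suc t) j - u t j)"
    proof (rule summable_comparison_test')
      show "summable (\<lambda>t. c * q ^ t)" using q by (intro summable_mult summable_geometric) auto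
      show "norm (u (Suc t) j - u t j) \<le> c * q ^ t" if "0 \<le> t" for t
        using abs_component_le_enorm[OF True, of "\<lambda>i. u (Suc t) i - u t i"] step[of t] by simp
    qed
    then have "(\<lambda>t. \<Sum>s<t. u (Suc s) j - u s j) \<longlonglongrightarrow> (\<Sum>t. u (Suc t) j - u t j)"
      by (rule summable_LIMSEQ)
    then have "(\<lambda>t. u t j - u 0 j + u 0 j) \<longlonglongrightarrow> (\<Sum>t. u (Suc t) j - u t j) + u 0 j"
      unfolding sum_lessThan_telescope[of "\<lambda>t. u t j"] by (intro tendsto_add tendsto_const)
    then show ?thesis by auto
  next
    case False
    then have "(\<lambda>t. u t j) = (\<lambda>t. 0)" using u by (auto simp: mem_Rd_iff)
    then show ?thesis by auto
  qed
  then obtain z where z: "(\<lambda>t. u t j) \<longlonglongrightarrow> z j" for j by metis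
  have zR: "z \<in> Rd d"
    unfolding mem_Rd_iff
  proof (intro allI impI)
    fix j assume "d \<le> j"
    then have "(\<lambda>t. u t j) = (\<lambda>t. 0)" using u by (auto simp: mem_Rd_iff)
    with z[of j] show "z j = 0" by (simp add: LIMSEQ_const_iff)
  qed
  have dist: "(\<lambda>t. enorm d (\<lambda>i. z i - u t i)) \<longlonglongrightarrow> enorm d (\<lambda>i. z i - z i)"
    unfolding enorm_def L2_set_def by (intro tendsto_intros z)
  have q0: "(\<lambda>t. q ^ t) \<longlonglongrightarrow> 0" using q by (intro LIMSEQ_power_zero) auto
  \<comment> \<open>\<open>smooth_descent\<close> at \<open>u t\<close> bounds \<open>h z\<close>
    from above; the gap, the gradient and the distance to \<open>z\<close> all tend to 0.\<close>
  have "h z \<le> min_value d h"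
  proof (rule LIMSEQ_le_const)
    show "(\<lambda>t. (min_value d h + \<Delta> * (q ^ t)\<^sup>2) + L * (c * q ^ t) * enorm d (\<lambda>i. z i - u t i)
        + L / 2 * (enorm d (\<lambda>i. z i - u t i))\<^sup>2)
        \<longlonglongrightarrow> min_value d h"
    proof -
      have "(\<lambda>t. (min_value d h + \<Delta> * (q ^ t)\<^sup>2) + L * (c * q ^ t) * enorm d (\<lambda>i. z i - u t i)
          + L / 2 * (enorm d (\<lambda>i. z i - u t i))\<^sup>2)
        \<longlonglongrightarrow> (min_value d h + \<Delta> * 0\<^sup>2) + L * (c * 0) * enorm d (\<lambda>i. z i - z i)
          + L / 2 * (enorm d (\<lambda>i. z i - z i))\<^sup>2"
        by (intro tendsto_intros dist q0)
      then show ?thesis by simp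
    qed
    show "\<exists>N. \<forall>t\<ge>N. h z \<le> (min_value d h + \<Delta> * (q ^ t)\<^sup>2)
        + L * (c * q ^ t) * enorm d (\<lambda>i. z i - u t i) + L / 2 * (enorm d (\<lambda>i. z i - u t i))\<^sup>2"
    proof (intro exI allI impI)
      fix t :: nat
      have "eip d (grad d h (u t)) (\<lambda>i. z i - u t i)
          \<le> enorm d (grad d h (u t)) * enorm d (\<lambda>i. z i - u t i)" by (rule eip_le)
      also have "\<dots> \<le> L * (c * q ^ t) * enorm d (\<lambda>i. z i - u t i)"
        using gr[of t] L by (intro mult_right_mono) (auto simp: divide_le_eq mult_ac)
      finally show "h z \<le> (min_value d h + \<Delta> * (q ^ t)\<^sup>2)
        + L * (c * q ^ t) * enorm d (\<lambda>i. z i - u t i) + L / 2 * (enorm d (\<lambda>i. z i - u t i))\<^sup>2"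
        using smooth_descent[OF h u[of t] zR] gap[of t] by linarith
    qed
  qed
  then have "z \<in> minimizers d h"
    using zR minimizers_le[OF m] by (auto simp: minimizers_def intro: order_trans)
  moreover have "enorm d (\<lambda>i. x i - z i) \<le> c / (1 - q)"
  proof (rule LIMSEQ_le_const2)
    show "(\<lambda>t. enorm d (\<lambda>i. x i - u t i)) \<longlonglongrightarrow> enorm d (\<lambda>i. x i - z i)"
      unfolding enorm_def L2_set_def by (intro tendsto_intros z)
  qed (use path in auto)
  ultimately show ?thesis unfolding c_def q_def \<Delta>_def by auto
qed

lemma continuous_on_enorm: "continuous_on A (enorm d)"
  unfolding enorm_def[abs_def] L2_set_def
  by (intro continuous_intros continuous_on_product_coordinates[THEN continuous_on_subset]) auto

text \<open>Compactness of the set of minimizers enters here: the set is bounded in norm, and by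
  \<open>pl_dist_minimizer\<close> the sublevel set lies within a fixed distance of it.\<close>

lemma pl_sublevel_bounded:
  assumes h: "h \<in> smooth_class d L" and L: "0 < L" and \<mu>: "0 < \<mu>"
    and pl: "polyak_lojasiewicz d \<mu> h" and K: "compact (minimizers d h)"
  shows "\<exists>R. \<forall>x\<in>Rd d. h x \<le> a \<longrightarrow> enorm d x \<le> R"
proof -
  have "compact (enorm d ` minimizers d h)"
    by (intro compact_continuous_image continuous_on_enorm K)
  then obtain M where M: "\<And>z. z \<in> minimizers d h \<Longrightarrow> enorm d z \<le> M"
    using bounded_imp_bdd_above[OF compact_imp_bounded] by (fastforce simp: bdd_above_def)
  let ?c = "L * (1 - exp (- \<mu> / (2 * L)))"
  have c: "0 < ?c" using L \<mu> by simp
  show ?thesis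
  proof (intro exI ballI impI)
    fix x assume x: "x \<in> Rd d" and a: "h x \<le> a"
    obtain z where z: "z \<in> minimizers d h"
        "enorm d (\<lambda>i. x i - z i) \<le> sqrt (2 * L * (h x - min_value d h)) / ?c"
      using pl_dist_minimizer[OF h L \<mu> pl x] by blast
    have "enorm d x \<le> enorm d z + enorm d (\<lambda>i. x i - z i)"
      using enorm_add[of d z "\<lambda>i. x i - z i"] by simp
    also have "enorm d z \<le> M" by (rule M[OF z(1)])
    also note z(2)
    also have "sqrt (2 * L * (h x - min_value d h)) / ?c \<le> sqrt (2 * L * (a - min_value d h)) / ?c"
      using a L c by (intro divide_right_mono real_sqrt_le_mono mult_left_mono) auto
    finally show "enorm d x \<le> M + sqrt (2 * L * (a - min_value d h)) / ?c" by simp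
  qed
qed

text \<open>The supremum in \<open>grad_bound\<close> is an upper bound once its set is known to be
  bounded. On the bounded sublevel set this follows by comparing each gradient with the one at the
  origin.\<close>

lemma enorm_grad_le_grad_bound:
  assumes n: "0 < n" and f: "\<And>i. i \<in> {1..n} \<Longrightarrow> f i \<in> smooth_class d L"
    and L: "0 < L" and \<mu>: "0 < \<mu>"
    and pl: "polyak_lojasiewicz d \<mu> (avg n f)" and K: "compact (minimizers d (avg n f))"
    and x: "x \<in> Rd d" "avg n f x \<le> avg n f x0" and i: "i \<in> {1..n}"
  shows "enorm d (grad d (f i) x) \<le> grad_bound d n f x0"
proof -
  let ?M = "\<lambda>x. MAX i\<in>{1..n}. enorm d (grad d (f i) x)"
  obtain R where R: "\<And>x. x \<in> Rd d \<Longrightarrow> avg n f x \<le> avg n f x0 \<Longrightarrow> enorm d x \<le> R"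
    using pl_sublevel_bounded[OF avg_smooth[OF n f] L \<mu> pl K] by blast
  have 0: "(\<lambda>i. 0) \<in> Rd d" by (simp add: mem_Rd_iff)
  have "enorm d (grad d (f i) x) \<le> ?M x" using i by (intro Max_ge) auto
  also have "\<dots> \<le> grad_bound d n f x0"
    unfolding grad_bound_def
  proof (rule cSUP_upper)
    show "bdd_above (?M ` {x \<in> Rd d. avg n f x \<le> avg n f x0})"
    proof (rule bdd_aboveI2)
      fix y assume y: "y \<in> {x \<in> Rd d. avg n f x \<le> avg n f x0}"
      show "?M y \<le> ?M (\<lambda>i. 0) + L * R"
      proof (rule Max.boundedI)
        fix a assume "a \<in> (\<lambda>i. enorm d (grad d (f i) y)) ` {1..n}"
        then obtain k where k: "k \<in> {1..n}" "a = enorm d (grad d (f k) y)" by auto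
        have "a \<le> enorm d (grad d (f k) (\<lambda>i. 0))
            + enorm d (\<lambda>j. grad d (f k) y j - grad d (f k) (\<lambda>i. 0) j)"
          using enorm_add[of d "grad d (f k) (\<lambda>i. 0)" "\<lambda>j. grad d (f k) y j - grad d (f k) (\<lambda>i. 0) j"]
          by (simp add: k)
        also have "enorm d (\<lambda>j. grad d (f k) y j - grad d (f k) (\<lambda>i. 0) j)
            \<le> L * enorm d (\<lambda>j. y j - (\<lambda>i. 0) j)"
          using f[OF k(1)] y 0 unfolding smooth_class_def by blast
        also have "\<dots> \<le> L * R" using R[of y] y L by simp
        also have "enorm d (grad d (f k) (\<lambda>i. 0)) \<le> ?M (\<lambda>i. 0)" using k by (intro Max_ge) auto
        finally show "a \<le> ?M (\<lambda>i. 0) + L * R" by simp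
      qed (use n in auto)
    qed
  qed (use x in auto)
  finally show ?thesis .
qed

section \<open>One epoch\<close>

lemma epoch_quadratic_bound:
  fixes A \<beta> r s :: real
  assumes "0 \<le> A" "0 \<le> \<beta>" "0 \<le> r" "r \<le> A / 4 + \<beta>" "0 \<le> s" "s \<le> 1 / 5"
  shows "- (A\<^sup>2 - A * r) + s / 2 * (A + r)\<^sup>2 \<le> - (A\<^sup>2 / 2) + 5 * \<beta>\<^sup>2"
proof -
  have "A * r \<le> A * (A / 4 + \<beta>)" using assms by (intro mult_left_mono) auto
  moreover have "s / 2 * (A + r)\<^sup>2 \<le> 1 / 10 * (A + (A / 4 + \<beta>))\<^sup>2"
    using assms by (intro mult_mono power_mono) auto
  \<comment> \<open>The other estimates leave a spare \<open>3 / 32 * A\<^sup>2\<close> against the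
    cross term \<open>5 / 4 * (A * \<beta>)\<close>. This square trades the cross term for
    \<open>9 / 100 * A\<^sup>2\<close> and a multiple of \<open>\<beta>\<^sup>2\<close> that fits
    into 5.\<close>
  moreover have "0 \<le> (3 / 10 * A - 25 / 12 * \<beta>)\<^sup>2" by simp
  moreover have "A * (A / 4 + \<beta>) = A\<^sup>2 / 4 + A * \<beta>"
    "1 / 10 * (A + (A / 4 + \<beta>))\<^sup>2 = 5 / 32 * A\<^sup>2 + 1 / 4 * (A * \<beta>) + \<beta>\<^sup>2 / 10"
    "(3 / 10 * A - 25 / 12 * \<beta>)\<^sup>2 = 9 / 100 * A\<^sup>2 - 5 / 4 * (A * \<beta>) + 625 / 144 * \<beta>\<^sup>2"
    by (simp_all add: power2_eq_square algebra_simps)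
  moreover have "0 \<le> A\<^sup>2" "0 \<le> \<beta>\<^sup>2" by simp_all
  ultimately show ?thesis by linarith
qed

text \<open>The whole epoch is treated as a single step of size \<open>\<eta> * n\<close> along
  \<open>a - r\<close>, where \<open>a\<close> is the gradient of the average at \<open>x\<close>
  and \<open>r\<close> collects the drift of the component gradients along the epoch.\<close>

lemma epoch_progress:
  fixes \<eta> D :: real and y :: "nat \<Rightarrow> vec"
  assumes n: "0 < n" and f: "\<And>i. i \<in> {1..n} \<Longrightarrow> f i \<in> smooth_class d L" and L: "0 < L"
    and pl: "polyak_lojasiewicz d \<mu> (avg n f)" and x: "x \<in> Rd d" and p: "p permutes {1..n}"
    and \<eta>: "0 \<le> \<eta>" "\<eta> * n * L \<le> 1 / 5"
    and y0: "y 0 = x"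
    and yS: "\<And>i. y (Suc i) = (\<lambda>j. y i j - \<eta> * grad d (f (p (Suc i))) (y i) j)"
    and dev: "\<And>i. i \<in> {1..n} \<Longrightarrow>
      enorm d (\<lambda>j. (\<Sum>k=1..i. grad d (f (p k)) x j) - i * grad d (avg n f) x j) \<le> D"
  shows "y n \<in> Rd d"
    and "avg n f (y n) - min_value d (avg n f)
      \<le> (1 - \<eta> * n * \<mu>) * (avg n f x - min_value d (avg n f)) + \<eta> * n * (8 * L\<^sup>2 * \<eta>\<^sup>2 * D\<^sup>2)"
proof -
  define F where "F = avg n f"
  define a where "a = grad d F x"
  define A where "A = enorm d a"
  define g where "g = (\<lambda>k. grad d (f (p (Suc k))))"
  \<comment> \<open>The solution of \<open>R = \<eta> * (n * A + D) + R / 5\<close>, where the last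
    term bounds the effect of the drift because \<open>\<eta> * n * L\<close> is at most 1 /
    5.\<close>
  define R where "R = 5 / 4 * (\<eta> * (n * A + D))"
  have pk: "p (Suc k) \<in> {1..n}" if "k < n" for k
    using permutes_in_image[OF p, of "Suc k"] that by auto
  have lip: "enorm d (\<lambda>j. g k u j - g k v j) \<le> L * enorm d (\<lambda>j. u j - v j)"
    if "k < n" "u \<in> Rd d" "v \<in> Rd d" for k u v
    using f[OF pk[OF that(1)]] that by (auto simp: smooth_class_def g_def)
  have gR: "g k u \<in> Rd d" if "k < n" "u \<in> Rd d" for k u
    using f[OF pk[OF that(1)]] that unfolding g_def
    by (intro grad_in_Rd) (auto simp: smooth_class_def)
  have A0: "0 \<le> A" by (simp add: A_def)
  have D0: "0 \<le> D" using order_trans[OF enorm_nonneg dev[of n]] n by auto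
  have S: "enorm d (\<lambda>j. \<Sum>k<i. g k x j) \<le> n * A + D" if i: "i \<le> n" for i
  proof -
    have "enorm d (\<lambda>j. (\<Sum>k<i. g k x j) - i * a j) \<le> D"
    proof (cases "i = 0")
      case False
      with i dev[of i] show ?thesis
        by (simp add: sum.atLeast1_atMost_eq g_def a_def F_def)
    qed (simp add: D0)
    moreover have "enorm d (\<lambda>j. i * a j) \<le> n * A"
      using i A0 by (simp add: enorm_scale A_def mult_right_mono)
    ultimately show ?thesis
      using enorm_add[of d "\<lambda>j. (\<Sum>k<i. g k x j) - i * a j" "\<lambda>j. i * a j"] by simp
  qed
  have ysum: "y i j - x j = - \<eta> * (\<Sum>k<i. g k (y k) j)" for i j
    by (induction i) (simp_all add: y0 yS g_def algebra_simps)
  have R0: "0 \<le> R" using \<eta> A0 D0 by (simp add: R_def)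
  \<comment> \<open>Strong induction, since the displacement at step \<open>i\<close> contains the
    component gradients at all earlier iterates, each within \<open>L * R\<close> of its value at
    \<open>x\<close>.\<close>
  have ybound: "i \<le> n \<Longrightarrow> y i \<in> Rd d \<and> enorm d (\<lambda>j. y i j - x j) \<le> R" for i
  proof (induction i rule: less_induct)
    case (less i)
    have yR: "y i \<in> Rd d"
    proof (cases i)
      case (Suc k)
      with less gR[of k "y k"] show ?thesis by (auto simp: yS mem_Rd_iff g_def)
    qed (simp add: y0 x)
    have "(\<lambda>j. y i j - x j)
        = (\<lambda>j. (- \<eta>) * ((\<Sum>k<i. g k x j) + (\<Sum>k<i. g k (y k) j - g k x j)))"
      by (simp add: ysum sum_subtractf)
    then have "enorm d (\<lambda>j. y i j - x j)
        = \<eta> * enorm d (\<lambda>j. (\<Sum>k<i. g k x j) + (\<Sum>k<i. g k (y k) j - g k x j))"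
      using \<eta> by (simp only: enorm_scale) simp
    also have "\<dots> \<le> \<eta> * ((n * A + D) + n * (L * R))"
    proof (intro mult_left_mono order_trans[OF enorm_add] add_mono S \<eta>)
      have "enorm d (\<lambda>j. \<Sum>k<i. g k (y k) j - g k x j)
          \<le> (\<Sum>k<i. enorm d (\<lambda>j. g k (y k) j - g k x j))" by (rule enorm_sum)
      also have "\<dots> \<le> (\<Sum>k<i. L * R)"
      proof (rule sum_mono)
        fix k assume "k \<in> {..<i}"
        then have k: "k < n" "y k \<in> Rd d" "enorm d (\<lambda>j. y k j - x j) \<le> R"
          using less by auto
        show "enorm d (\<lambda>j. g k (y k) j - g k x j) \<le> L * R"
          using lip[OF k(1,2) x] mult_left_mono[OF k(3), of L] L by linarith
      qed
      also have "\<dots> \<le> n * (L * R)"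
        using less.prems L R0 by (simp add: mult_right_mono)
      finally show "enorm d (\<lambda>j. \<Sum>k<i. g k (y k) j - g k x j) \<le> n * (L * R)" .
    qed (use less in auto)
    also have "\<dots> = 4 / 5 * R + (\<eta> * n * L) * R" by (simp add: R_def algebra_simps)
    also have "\<dots> \<le> 4 / 5 * R + 1 / 5 * R"
      using \<eta> R0 by (intro add_left_mono mult_right_mono) auto
    finally show ?case using yR by simp
  qed
  then show yn: "y n \<in> Rd d" by simp
  define r where "r = (\<lambda>j. (1 / n) * (\<Sum>k<n. g k x j - g k (y k) j))"
  have r: "enorm d r \<le> L * R"
  proof -
    have "enorm d r = (1 / n) * enorm d (\<lambda>j. \<Sum>k<n. g k x j - g k (y k) j)"
      unfolding r_def by (simp only: enorm_scale) simp
    also have "\<dots> \<le> (1 / n) * (\<Sum>k<n. enorm d (\<lambda>j. g k x j - g k (y k) j))"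
      by (intro mult_left_mono enorm_sum) auto
    also have "\<dots> \<le> (1 / n) * (\<Sum>k<n. L * R)"
    proof (intro mult_left_mono sum_mono)
      fix k assume "k \<in> {..<n}"
      then have k: "k < n" "y k \<in> Rd d" "enorm d (\<lambda>j. x j - y k j) \<le> R"
        using ybound[of k] by (auto simp: enorm_minus_commute[of d x])
      show "enorm d (\<lambda>j. g k x j - g k (y k) j) \<le> L * R"
        using lip[OF k(1) x k(2)] mult_left_mono[OF k(3), of L] L by linarith
    qed auto
    also have "\<dots> = L * R" using n by simp
    finally show ?thesis .
  qed
  have a: "a j = (1 / n) * (\<Sum>k<n. g k x j)" for j
  proof -
    have "a j = (\<Sum>i=1..n. grad d (f i) x j) / n"
      unfolding a_def F_def using f x by (subst grad_avg) (auto simp: smooth_class_def)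
    also have "(\<Sum>i=1..n. grad d (f i) x j) = (\<Sum>i=1..n. grad d (f (p i)) x j)"
      using sum.permute[OF p, of "\<lambda>i. grad d (f i) x j"] by (simp add: o_def)
    finally show ?thesis by (simp add: g_def sum.atLeast1_atMost_eq)
  qed
  have disp: "(\<lambda>j. y n j - x j) = (\<lambda>j. - (\<eta> * n) * (a j - r j))"
  proof
    fix j
    have "a j - r j = (1 / n) * (\<Sum>k<n. g k (y k) j)"
      by (simp add: a r_def sum_subtractf algebra_simps)
    with ysum[of n j] n show "y n j - x j = - (\<eta> * n) * (a j - r j)" by simp
  qed
  define s where "s = \<eta> * n * L"
  have s: "0 \<le> s" "s \<le> 1 / 5" using \<eta> L by (auto simp: s_def)
  \<comment> \<open>The part of \<open>L * R\<close> that stems from the deviation \<open>D\<close>;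
    the rest is at most \<open>A / 4\<close> and is absorbed by the descent.\<close>
  define \<beta> where "\<beta> = 5 / 4 * (L * \<eta> * D)"
  have "L * R = 5 / 4 * s * A + \<beta>" by (simp add: R_def s_def \<beta>_def algebra_simps)
  also have "5 / 4 * s * A \<le> A / 4"
    using mult_right_mono[OF s(2) A0] by (simp add: mult_ac)
  finally have rb: "enorm d r \<le> A / 4 + \<beta>" using r by simp
  have "F (y n) \<le> F x + eip d a (\<lambda>j. y n j - x j) + L / 2 * (enorm d (\<lambda>j. y n j - x j))\<^sup>2"
    unfolding a_def F_def by (rule smooth_descent[OF avg_smooth[OF n f] x yn])
  also have "eip d a (\<lambda>j. y n j - x j) = - (\<eta> * n) * (A\<^sup>2 - eip d a r)"
    unfolding disp by (simp only: eip_scale_right eip_diff_right A_def enorm_power2)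
  also have "L / 2 * (enorm d (\<lambda>j. y n j - x j))\<^sup>2
      = (\<eta> * n) * (s / 2 * (enorm d (\<lambda>j. a j - r j))\<^sup>2)"
    unfolding disp by (simp only: enorm_scale) (simp add: s_def power2_eq_square)
  finally have "F (y n) \<le> F x
      + (\<eta> * n) * (- (A\<^sup>2 - eip d a r) + s / 2 * (enorm d (\<lambda>j. a j - r j))\<^sup>2)"
    by (simp add: algebra_simps)
  also have "\<dots> \<le> F x + (\<eta> * n) * (- (A\<^sup>2 - A * enorm d r) + s / 2 * (A + enorm d r)\<^sup>2)"
    using \<eta> s eip_le[of d a r] enorm_diff[of d a r]
    by (intro add_left_mono mult_left_mono add_mono power_mono) (auto simp: A_def)
  also have "\<dots> \<le> F x + (\<eta> * n) * (- (A\<^sup>2 / 2) + 5 * \<beta>\<^sup>2)"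
    using \<eta> L A0 D0 rb s by (intro add_left_mono mult_left_mono epoch_quadratic_bound)
      (auto simp: \<beta>_def)
  \<comment> \<open>The Polyak-Lojasiewicz inequality turns the squared gradient into the gap, and
    \<open>5 * \<beta>\<^sup>2\<close> has the coefficient 125 / 16, which is rounded up to
    8.\<close>
  also have "\<dots> \<le> F x + (\<eta> * n) * (- (\<mu> * (F x - min_value d F)) + 8 * L\<^sup>2 * \<eta>\<^sup>2 * D\<^sup>2)"
  proof (intro add_left_mono mult_left_mono add_mono)
    show "- (A\<^sup>2 / 2) \<le> - (\<mu> * (F x - min_value d F))"
      using pl x by (simp add: polyak_lojasiewicz_def A_def a_def F_def)
    show "5 * \<beta>\<^sup>2 \<le> 8 * L\<^sup>2 * \<eta>\<^sup>2 * D\<^sup>2"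
      by (simp add: \<beta>_def power_mult_distrib power_divide)
  qed (use \<eta> in auto)
  finally show "avg n f (y n) - min_value d (avg n f)
      \<le> (1 - \<eta> * n * \<mu>) * (avg n f x - min_value d (avg n f)) + \<eta> * n * (8 * L\<^sup>2 * \<eta>\<^sup>2 * D\<^sup>2)"
    unfolding F_def by (simp add: algebra_simps)
qed

section \<open>All epochs\<close>

text \<open>
  Either some epoch starts below the noise level \<open>B\<close>, or the objective values decrease, so that
  all epochs start in the initial sublevel set, where the deviation bound is available.
\<close>

lemma shuffle_min_bound:
  fixes \<eta> D :: real and X :: "nat \<Rightarrow> vec"
  assumes n: "0 < n" and f: "\<And>i. i \<in> {1..n} \<Longrightarrow> f i \<in> smooth_class d L" and L: "0 < L"
    and \<mu>: "0 < \<mu>"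
    and pl: "polyak_lojasiewicz d \<mu> (avg n f)" and x0: "x0 \<in> Rd d"
    and \<sigma>: "\<And>k. k \<in> {1..K} \<Longrightarrow> \<sigma> k permutes {1..n}"
    and \<eta>: "0 \<le> \<eta>" "\<eta> * n * L \<le> 1 / 5"
    and X: "X = (\<lambda>k. shuffle_iter d n f (\<lambda>_ _. \<eta>) \<sigma> x0 k 0)"
    and dev: "\<And>k i. k \<in> {1..K} \<Longrightarrow> i \<in> {1..n} \<Longrightarrow> X k \<in> Rd d \<Longrightarrow> avg n f (X k) \<le> avg n f x0 \<Longrightarrow>
      enorm d (\<lambda>j. (\<Sum>s=1..i. grad d (f (\<sigma> k s)) (X k) j) - i * grad d (avg n f) (X k) j) \<le> D"
  shows "\<exists>k\<in>{1..K + 1}. avg n f (X k) - min_value d (avg n f)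
    \<le> exp (- (\<eta> * n * \<mu> * K)) * (avg n f x0 - min_value d (avg n f)) + 8 * L\<^sup>2 * \<eta>\<^sup>2 * D\<^sup>2 / \<mu>"
proof -
  define u where "u = (\<lambda>k. avg n f (X k) - min_value d (avg n f))"
  define B where "B = 8 * L\<^sup>2 * \<eta>\<^sup>2 * D\<^sup>2 / \<mu>"
  define z where "z = \<eta> * n * \<mu>"
  have m: "minimizers d (avg n f) \<noteq> {}" using pl by (simp add: polyak_lojasiewicz_def)
  have X1: "X 1 = x0" by (simp add: X)
  have B0: "0 \<le> B" using \<mu> by (simp add: B_def)
  have u1: "0 \<le> u 1" using minimizers_le[OF m x0] unfolding u_def X1 by simp
  have z0: "0 \<le> z" using \<eta> \<mu> by (simp add: z_def)
  show ?thesis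
  proof (cases "\<exists>k\<in>{1..K + 1}. u k \<le> B")
    case True
    then obtain k where "k \<in> {1..K + 1}" "u k \<le> B" by blast
    moreover have "0 \<le> exp (- (\<eta> * n * \<mu> * K)) * u 1" using u1 by simp
    ultimately show ?thesis unfolding u_def B_def X1 by (intro bexI[of _ k]) linarith+
  next
    case False
    then have large: "B < u k" if "k \<in> {1..K + 1}" for k using that by force
    \<comment> \<open>Shifted by one because epoch 1 starts at \<open>x0\<close>. The bound by
      \<open>u 1\<close> keeps the starting point in the initial sublevel set, as \<open>dev\<close>
      requires in the next epoch.\<close>
    have "k \<le> K \<Longrightarrow> X (Suc k) \<in> Rd d \<and> u (Suc k) \<le> u 1 \<and> u (Suc k) - B \<le> exp (- z) ^ k * (u 1 - B)"
      for k
    proof (induction k)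
      case 0
      then show ?case using X1 x0 by simp
    next
      case (Suc k)
      then have IH: "X (Suc k) \<in> Rd d" "u (Suc k) \<le> u 1" "u (Suc k) - B \<le> exp (- z) ^ k * (u 1 - B)"
        and k: "Suc k \<in> {1..K}" by auto
      have le: "avg n f (X (Suc k)) \<le> avg n f x0" using IH(2) X1 by (simp add: u_def)
      define y where "y = shuffle_iter d n f (\<lambda>_ _. \<eta>) \<sigma> x0 (Suc k)"
      have y0: "y 0 = X (Suc k)" unfolding y_def X by (rule refl)
      have yS: "y (Suc i) = (\<lambda>j. y i j - \<eta> * grad d (f (\<sigma> (Suc k) (Suc i))) (y i) j)" for i
        by (simp add: y_def Let_def)
      have yn: "y n = X (Suc (Suc k))" by (simp add: y_def X)
      note progress = epoch_progress[OF n f L pl IH(1) \<sigma>[OF k] \<eta> y0 yS dev[OF k _ IH(1) le],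
          unfolded yn]
      have "u (Suc (Suc k)) \<le> (1 - z) * u (Suc k) + \<eta> * n * (8 * L\<^sup>2 * \<eta>\<^sup>2 * D\<^sup>2)"
        unfolding u_def z_def using progress(2) by simp
      \<comment> \<open>\<open>B\<close> is the fixed point of the recursion
        \<open>u \<mapsto> (1 - z) * u + z * B\<close>, so the excess over \<open>B\<close>
        contracts. That the excess is nonnegative permits replacing \<open>1 - z\<close> by
        \<open>exp (- z)\<close>.\<close>
      also have "\<eta> * n * (8 * L\<^sup>2 * \<eta>\<^sup>2 * D\<^sup>2) = z * B" using \<mu> by (simp add: z_def B_def)
      finally have step: "u (Suc (Suc k)) - B \<le> (1 + - z) * (u (Suc k) - B)"
        by (simp add: algebra_simps)
      have pos: "0 \<le> u (Suc k) - B" using large[of "Suc k"] Suc.prems by simp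
      have "u (Suc (Suc k)) \<le> u (Suc k)"
        using step mult_nonneg_nonneg[OF z0 pos] by (simp add: algebra_simps)
      moreover have "u (Suc (Suc k)) - B \<le> exp (- z) * (u (Suc k) - B)"
        using step mult_right_mono[OF exp_ge_add_one_self[of "- z"] pos] by linarith
      then have "u (Suc (Suc k)) - B \<le> exp (- z) * (exp (- z) ^ k * (u 1 - B))"
        by (rule order_trans) (use IH(3) in \<open>intro mult_left_mono, auto\<close>)
      ultimately show ?case using progress(1) IH(2) by (simp add: mult.assoc)
    qed
    from this[of K] have "u (Suc K) - B \<le> exp (- z) ^ K * (u 1 - B)" by simp
    also have "\<dots> \<le> exp (- z) ^ K * u 1" using B0 by (intro mult_left_mono) auto
    also have "exp (- z) ^ K = exp (- (z * K))" by (simp add: mult.commute flip: exp_of_nat_mult)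
    finally have "u (Suc K) \<le> exp (- (z * K)) * u 1 + B" by simp
    then show ?thesis unfolding u_def B_def X1 z_def by (intro bexI[of _ "Suc K"]) auto
  qed
qed

section \<open>Independence of the epochs and the union bound\<close>

lemma shuffle_iter_cong:
  assumes "\<And>k'. 1 \<le> k' \<Longrightarrow> k' \<le> k \<Longrightarrow> \<sigma> k' = \<tau> k'"
  shows "shuffle_iter d n f \<eta> \<sigma> x0 k i = shuffle_iter d n f \<eta> \<tau> x0 k i"
  using assms
  by (induction d n f \<eta> \<sigma> x0 k i rule: shuffle_iter.induct) (simp_all add: Let_def)

text \<open>Epoch \<open>k\<close> starts at a point determined by the earlier permutations.
  Resampling the \<open>k\<close>-th one leaves that point fixed, so the deviation in epoch
  \<open>k\<close> concerns a single uniform permutation.\<close>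

lemma shuffle_start_upd:
  "shuffle_iter d n f \<eta> (\<sigma>(k := p)) x0 k 0 = shuffle_iter d n f \<eta> \<sigma> x0 k 0"
proof (cases k)
  case (Suc k')
  then show ?thesis using shuffle_iter_cong[of k' "\<sigma>(k := p)" \<sigma> d n f \<eta> x0 n] by simp
qed simp

text \<open>By independence, coordinate \<open>k\<close> may be drawn last; a bound valid for all
  values of the other coordinates survives averaging over them.\<close>

lemma Pi_pmf_prob_le:
  assumes I: "finite I" "k \<in> I"
    and q: "\<And>a. measure_pmf.prob (M k) {y. a(k := y) \<in> A} \<le> q"
  shows "measure_pmf.prob (Pi_pmf I dflt M) A \<le> q"
proof -
  define Q where "Q = Pi_pmf (I - {k}) dflt M"
  have q0: "0 \<le> q" using order_trans[OF measure_nonneg q] .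
  have "Pi_pmf I dflt M = Pi_pmf (insert k (I - {k})) dflt M" using I by (simp add: insert_absorb)
  also have "\<dots> = bind_pmf Q (\<lambda>a. map_pmf (\<lambda>y. a(k := y)) (M k))"
    using I unfolding Q_def
    by (subst Pi_pmf_insert', simp, simp, subst bind_commute_pmf) (simp add: map_pmf_def)
  finally have "emeasure (Pi_pmf I dflt M) A
      = (\<integral>\<^sup>+a. emeasure (M k) {y. a(k := y) \<in> A} \<partial>Q)"
    by (simp add: vimage_def)
  also have "\<dots> \<le> (\<integral>\<^sup>+a. ennreal q \<partial>Q)"
    by (intro nn_integral_mono) (simp add: measure_pmf.emeasure_eq_measure q ennreal_leI)
  also have "\<dots> = ennreal q" by simp
  finally show ?thesis using q0 by (simp add: measure_pmf.emeasure_eq_measure)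
qed

text \<open>A union bound over the \<open>n * K\<close> pairs of epoch and prefix length. Membership
  of the random starting point in \<open>U\<close> is part of each bad event, so \<open>G\<close>
  bounds the gradients whenever the event can occur.\<close>

lemma shuffles_deviation_tail:
  fixes G t :: real and X :: "(nat \<Rightarrow> nat \<Rightarrow> nat) \<Rightarrow> nat \<Rightarrow> vec"
  assumes n: "0 < n" and diff: "\<And>i. i \<in> {1..n} \<Longrightarrow> differentiable_Rd d (f i)"
    and G: "0 < G" "\<And>x i. x \<in> U \<Longrightarrow> i \<in> {1..n} \<Longrightarrow> enorm d (grad d (f i) x) \<le> G"
    and U: "U \<subseteq> Rd d" and t: "0 \<le> t"
    and X: "X = (\<lambda>\<sigma> k. shuffle_iter d n f \<eta> \<sigma> x0 k 0)"
  shows "measure_pmf.prob (shuffles_pmf n K) {\<sigma>. \<exists>k\<in>{1..K}. \<exists>i\<in>{1..n}. X \<sigma> k \<in> U \<and>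
      t < enorm d (\<lambda>j. (\<Sum>s=1..i. grad d (f (\<sigma> k s)) (X \<sigma> k) j) - i * grad d (avg n f) (X \<sigma> k) j)}
    \<le> real n * real K * exp (1 - t\<^sup>2 / (24 * real n * G\<^sup>2))"
proof -
  define Bad where "Bad = (\<lambda>(k, i). {\<sigma>. X \<sigma> k \<in> U \<and>
      t < enorm d (\<lambda>j. (\<Sum>s=1..i. grad d (f (\<sigma> k s)) (X \<sigma> k) j) - i * grad d (avg n f) (X \<sigma> k) j)})"
  define q where "q = exp (1 - t\<^sup>2 / (24 * real n * G\<^sup>2))"
  have bad: "measure_pmf.prob (shuffles_pmf n K) (Bad (k, i)) \<le> q"
    if k: "k \<in> {1..K}" and i: "i \<in> {1..n}" for k i
    unfolding shuffles_pmf_def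
  proof (rule Pi_pmf_prob_le)
    fix a :: "nat \<Rightarrow> nat \<Rightarrow> nat"
    define x where "x = X a k"
    have upd: "X (a(k := p)) k = x" for p unfolding x_def X by (rule shuffle_start_upd)
    show "measure_pmf.prob (pmf_of_set {p. p permutes {1..n}}) {p. a(k := p) \<in> Bad (k, i)} \<le> q"
    proof (cases "x \<in> U")
      case True
      then have "x \<in> Rd d" using U by blast
      then have gr: "grad d (avg n f) x = (\<lambda>j. (\<Sum>i=1..n. grad d (f i) x j) / n)"
        by (intro grad_avg diff)
      have "{p. a(k := p) \<in> Bad (k, i)} = {p. t < enorm d (\<lambda>j. (\<Sum>s\<in>{1..i}. grad d (f (p s)) x j)
          - card {1..i} * ((\<Sum>s\<in>{1..n}. grad d (f s) x j) / card {1..n}))}"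
        using True by (simp add: Bad_def upd gr)
      also have "measure_pmf.prob (pmf_of_set {p. p permutes {1..n}}) \<dots>
          \<le> exp (1 - t\<^sup>2 / (24 * real (card {1..n}) * G\<^sup>2))"
        by (rule permutation_deviation_tail) (use n i G True t in auto)
      finally show ?thesis by (simp add: q_def)
    next
      case False
      then show ?thesis by (simp add: Bad_def upd q_def)
    qed
  qed (use k in auto)
  have "{\<sigma>. \<exists>k\<in>{1..K}. \<exists>i\<in>{1..n}. X \<sigma> k \<in> U \<and>
      t < enorm d (\<lambda>j. (\<Sum>s=1..i. grad d (f (\<sigma> k s)) (X \<sigma> k) j) - i * grad d (avg n f) (X \<sigma> k) j)}
    = (\<Union>ki\<in>{1..K} \<times> {1..n}. Bad ki)"
    by (auto simp: Bad_def)
  also have "measure_pmf.prob (shuffles_pmf n K) \<dots>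
      \<le> (\<Sum>ki\<in>{1..K} \<times> {1..n}. measure_pmf.prob (shuffles_pmf n K) (Bad ki))"
    by (intro measure_pmf.finite_measure_subadditive_finite) auto
  also have "\<dots> \<le> (\<Sum>ki\<in>{1..K} \<times> {1..n}. q)"
    by (intro sum_mono) (use bad in auto)
  also have "\<dots> = real n * real K * q" by (simp add: mult_ac)
  finally show ?thesis by (simp add: q_def)
qed

section \<open>Choice of the parameters and the final bound\<close>

text \<open>Working with \<open>G + 1\<close> spares the degenerate case \<open>G = 0\<close>.\<close>

lemma random_shuffle_bound:
  fixes f :: "nat \<Rightarrow> vec \<Rightarrow> real" and x0 :: vec and L \<mu> \<delta> \<eta> :: real and n d K :: nat
    and X :: "(nat \<Rightarrow> nat \<Rightarrow> nat) \<Rightarrow> nat \<Rightarrow> vec"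
  defines "F \<equiv> avg n f"
  defines "Fstar \<equiv> min_value d F"
  defines "G \<equiv> grad_bound d n f x0"
  defines "\<eta> \<equiv> 2 * ln (sqrt (real n) * real K) / (\<mu> * real n * real K)"
  defines "X \<equiv> \<lambda>\<sigma> k. shuffle_iter d n f (\<lambda>_ _. \<eta>) \<sigma> x0 k 0"
  defines "c \<equiv> 1920 * (G + 1)\<^sup>2 / L * (L / \<mu>) ^ 3"
  assumes n: "2 \<le> n" and L: "0 < L" and \<mu>: "0 < \<mu>" and K: "1 \<le> K" and \<delta>: "0 < \<delta>" "\<delta> < 1"
    and x0: "x0 \<in> Rd d" and f: "\<And>i. i \<in> {1..n} \<Longrightarrow> f i \<in> smooth_class d L"
    and pl: "polyak_lojasiewicz d \<mu> F" and comp: "compact (minimizers d F)"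
    and large: "real K \<ge> 10 * (L / \<mu>) * ln (sqrt (real n) * real K)"
  shows "measure_pmf.prob (shuffles_pmf n K)
      {\<sigma>. (MIN k\<in>{1..K + 1}. F (X \<sigma> k)) - Fstar
        \<le> (F x0 - Fstar) / (real n * real K ^ 2)
          + c * (ln (real n * real K)) ^ 2 * ln (real n * real K / \<delta>) / (real n * real K ^ 2)}
    \<ge> 1 - \<delta>"
proof -
  define N where "N = real n"
  define k' where "k' = real K"
  have N: "2 \<le> N" and k': "1 \<le> k'" using n K by (auto simp: N_def k'_def)
  have n0: "0 < n" using n by simp
  define l1 where "l1 = ln (sqrt N * k')"
  define l2 where "l2 = ln (N * k')"
  define l where "l = ln (N * k' / \<delta>)"
  have s1: "1 \<le> sqrt N" and sN: "sqrt N \<le> N"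
    using N by (auto intro!: real_le_lsqrt simp: power2_eq_square)
  have "1 * 1 \<le> sqrt N * k'" using s1 k' by (intro mult_mono) auto
  then have l1: "0 \<le> l1" by (simp add: l1_def)
  have l12: "l1 \<le> l2" unfolding l1_def l2_def using s1 sN k' N
    by (intro ln_mono mult_right_mono) auto
  have l23: "2 / 3 \<le> l"
  proof -
    have "2 * 1 \<le> N * k'" using N k' by (intro mult_mono) auto
    also have "\<dots> = N * k' / 1" by simp
    also have "\<dots> \<le> N * k' / \<delta>" using N k' \<delta> by (intro divide_left_mono) auto
    finally have "ln 2 \<le> l" unfolding l_def by (intro ln_mono) auto
    with ln2_ge_two_thirds show ?thesis by linarith
  qed
  have \<eta>: "\<eta> = 2 * l1 / (\<mu> * N * k')" by (simp add: \<eta>_def l1_def N_def k'_def)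
  have \<eta>0: "0 \<le> \<eta>" using l1 \<mu> N k' by (simp add: \<eta>)
  \<comment> \<open>\<open>\<eta> * n * L\<close> equals \<open>2 * (L / \<mu>) * l1 / K\<close>;
    the lower bound on \<open>K\<close> is made for this.\<close>
  have \<eta>L: "\<eta> * n * L \<le> 1 / 5"
    using large \<mu> N k' unfolding \<eta> N_def[symmetric] k'_def[symmetric] l1_def[symmetric]
    by (simp add: field_simps)
  have pl': "polyak_lojasiewicz d \<mu> (avg n f)" and comp': "compact (minimizers d (avg n f))"
    using pl comp by (simp_all add: F_def)
  define U where "U = {x \<in> Rd d. F x \<le> F x0}"
  have GU: "enorm d (grad d (f i) x) \<le> G" if "x \<in> U" "i \<in> {1..n}" for x i
    unfolding G_def using that
    by (intro enorm_grad_le_grad_bound[OF n0 f L \<mu> pl' comp']) (auto simp: U_def F_def)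
  have "x0 \<in> U" using x0 by (simp add: U_def)
  then have G0: "0 \<le> G" using order_trans[OF enorm_nonneg GU[of x0 1]] n by auto
  \<comment> \<open>Since 60 is 24 times 5 / 2, the tail exponent becomes
    \<open>1 - 5 / 2 * l\<close>. It is at most \<open>- l\<close> because \<open>l\<close> is at
    least 2 / 3, and \<open>exp (- l)\<close> compensates the union bound over \<open>n * K\<close>
    events exactly up to \<open>\<delta>\<close>.\<close>
  define D where "D = sqrt (60 * N * (G + 1)\<^sup>2 * l)"
  have D2: "D\<^sup>2 = 60 * N * (G + 1)\<^sup>2 * l" using N l23 by (simp add: D_def)
  define Bad where "Bad = {\<sigma>. \<exists>k\<in>{1..K}. \<exists>i\<in>{1..n}. X \<sigma> k \<in> U \<and>
      D < enorm d (\<lambda>j. (\<Sum>s=1..i. grad d (f (\<sigma> k s)) (X \<sigma> k) j) - i * grad d (avg n f) (X \<sigma> k) j)}"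
  have "measure_pmf.prob (shuffles_pmf n K) Bad \<le> real n * real K * exp (1 - D\<^sup>2 / (24 * real n * (G + 1)\<^sup>2))"
    unfolding Bad_def
  proof (rule shuffles_deviation_tail[OF n0, where U = U and X = X and \<eta> = "\<lambda>_ _. \<eta>" and ?x0.0 = x0])
    show "differentiable_Rd d (f i)" if "i \<in> {1..n}" for i
      using f[OF that] by (simp add: smooth_class_def)
    show "enorm d (grad d (f i) x) \<le> G + 1" if "x \<in> U" "i \<in> {1..n}" for x i
      using GU[OF that] by simp
  qed (use G0 N l23 in \<open>auto simp: U_def D_def X_def\<close>)
  also have "1 - D\<^sup>2 / (24 * real n * (G + 1)\<^sup>2) = 1 - 5 / 2 * l"
    using N G0 by (simp add: D2 N_def)
  also have "real n * real K * exp (1 - 5 / 2 * l) \<le> real n * real K * exp (- l)"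
    using l23 by (intro mult_left_mono exp_mono) auto
  also have "\<dots> = \<delta>"
    using N k' \<delta> by (simp add: l_def exp_minus N_def k'_def)
  finally have bad: "measure_pmf.prob (shuffles_pmf n K) Bad \<le> \<delta>" .
  \<comment> \<open>The logarithm in the step size is chosen so that \<open>K\<close> contractions
    amount to \<open>exp (- 2 * l1)\<close>, which is the inverse square of
    \<open>sqrt N * k'\<close>.\<close>
  have contract: "exp (- (\<eta> * n * \<mu> * K)) = 1 / (N * k'\<^sup>2)"
  proof -
    have "\<eta> * n * \<mu> * K = 2 * l1" using \<mu> N k' by (simp add: \<eta> N_def k'_def)
    also have "\<dots> = ln ((sqrt N * k')\<^sup>2)" using N k' by (simp add: l1_def ln_realpow)
    also have "(sqrt N * k')\<^sup>2 = N * k'\<^sup>2" using N by (simp add: power_mult_distrib)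
    finally show ?thesis using N k' by (simp add: exp_minus inverse_eq_divide)
  qed
  \<comment> \<open>The constant is 1920 = 8 * 4 * 60, from the noise level, the square of the 2 in
    \<open>\<eta>\<close>, and \<open>D\<^sup>2\<close>. The powers of \<open>\<mu>\<close> are two
    from \<open>\<eta>\<^sup>2\<close> and one from the division, which yields the cube of the
    condition number.\<close>
  have noise: "8 * L\<^sup>2 * \<eta>\<^sup>2 * D\<^sup>2 / \<mu> \<le> c * l2\<^sup>2 * l / (N * k'\<^sup>2)"
  proof -
    have "8 * L\<^sup>2 * \<eta>\<^sup>2 * D\<^sup>2 / \<mu> = c * l1\<^sup>2 * l / (N * k'\<^sup>2)"
      using L \<mu> N k' unfolding \<eta> D2 c_def
      by (simp add: power_divide power_mult_distrib field_simps power2_eq_square power3_eq_cube)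
    also have "\<dots> \<le> c * l2\<^sup>2 * l / (N * k'\<^sup>2)"
      using l1 l12 l23 L \<mu> N
      by (intro divide_right_mono mult_right_mono mult_left_mono power_mono) (auto simp: c_def)
    finally show ?thesis .
  qed
  let ?Good = "{\<sigma>. (MIN k\<in>{1..K + 1}. F (X \<sigma> k)) - Fstar
        \<le> (F x0 - Fstar) / (real n * real K ^ 2)
          + c * (ln (real n * real K)) ^ 2 * ln (real n * real K / \<delta>) / (real n * real K ^ 2)}"
  \<comment> \<open>Only on the support is every \<open>\<sigma> k\<close> known to be a
    permutation; off the support the measure is 0.\<close>
  have "- Bad \<inter> set_pmf (shuffles_pmf n K) \<subseteq> ?Good"
  proof
    fix \<sigma> assume "\<sigma> \<in> - Bad \<inter> set_pmf (shuffles_pmf n K)"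
    then have nb: "\<sigma> \<notin> Bad" and "\<sigma> \<in> set_pmf (shuffles_pmf n K)" by auto
    then have perm: "\<sigma> k permutes {1..n}" if "k \<in> {1..K}" for k
    proof -
      have "set_pmf (pmf_of_set {p. p permutes {1..n}}) = {p. p permutes {1..n}}"
        by (intro set_pmf_of_set) (auto intro: permutes_id finite_permutations)
      with \<open>\<sigma> \<in> set_pmf (shuffles_pmf n K)\<close> that show ?thesis
        by (auto simp: shuffles_pmf_def set_Pi_pmf PiE_dflt_def)
    qed
    have "\<exists>k\<in>{1..K + 1}. avg n f (X \<sigma> k) - min_value d (avg n f)
      \<le> exp (- (\<eta> * n * \<mu> * K)) * (avg n f x0 - min_value d (avg n f)) + 8 * L\<^sup>2 * \<eta>\<^sup>2 * D\<^sup>2 / \<mu>"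
    proof (rule shuffle_min_bound[OF n0 f L \<mu> pl' x0 perm \<eta>0 \<eta>L])
      show "X \<sigma> = (\<lambda>k. shuffle_iter d n f (\<lambda>_ _. \<eta>) \<sigma> x0 k 0)" by (simp add: X_def)
      show "enorm d (\<lambda>j. (\<Sum>s=1..i. grad d (f (\<sigma> k s)) (X \<sigma> k) j) - i * grad d (avg n f) (X \<sigma> k) j) \<le> D"
        if "k \<in> {1..K}" "i \<in> {1..n}" "X \<sigma> k \<in> Rd d" "avg n f (X \<sigma> k) \<le> avg n f x0" for k i
        using nb that by (force simp: Bad_def U_def F_def not_less)
    qed
    then obtain k where k: "k \<in> {1..K + 1}"
      "F (X \<sigma> k) - Fstar \<le> 1 / (N * k'\<^sup>2) * (F x0 - Fstar) + 8 * L\<^sup>2 * \<eta>\<^sup>2 * D\<^sup>2 / \<mu>"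
      unfolding contract F_def[symmetric] Fstar_def[symmetric] by blast
    have "(MIN k\<in>{1..K + 1}. F (X \<sigma> k)) \<le> F (X \<sigma> k)" using k by (intro Min_le) auto
    with k(2) noise show "\<sigma> \<in> ?Good"
      by (simp add: N_def k'_def l2_def l_def)
  qed
  then have "measure_pmf.prob (shuffles_pmf n K) (- Bad) \<le> measure_pmf.prob (shuffles_pmf n K) ?Good"
    unfolding measure_Int_set_pmf[of _ "- Bad", symmetric]
    by (intro measure_pmf.finite_measure_mono) auto
  moreover have "measure_pmf.prob (shuffles_pmf n K) (- Bad)
      = 1 - measure_pmf.prob (shuffles_pmf n K) Bad"
    using measure_pmf.prob_compl[of Bad "shuffles_pmf n K"] by (simp add: Compl_eq_Diff_UNIV)
  ultimately show ?thesis using bad by linarith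
qed

text \<open>Choosing \<open>C\<close> before all other data expresses that the constant in the cubic
  bound depends on \<open>L\<close> and \<open>G\<close> alone.\<close>

theorem theorem1:
  shows "\<exists>C :: real \<Rightarrow> real \<Rightarrow> real.
    \<forall>(n::nat) (d::nat) (f :: nat \<Rightarrow> (nat \<Rightarrow> real) \<Rightarrow> real) (L::real) (\<mu>::real)
      (x0 :: nat \<Rightarrow> real) (K::nat) (\<delta>::real).
      let F = avg n f;
          Fstar = min_value d F;
          \<kappa> = L / \<mu>;
          G = grad_bound d n f x0;
          \<eta> = 2 * ln (sqrt (real n) * real K) / (\<mu> * real n * real K);
          start = (\<lambda>\<sigma> k. shuffle_iter d n f (\<lambda>_ _. \<eta>) \<sigma> x0 k 0)
      in n \<ge> 2 \<longrightarrow> d \<ge> 1 \<longrightarrow> L > 0 \<longrightarrow> \<mu> > 0 \<longrightarrow> K \<ge> 1 \<longrightarrow> 0 < \<delta> \<longrightarrow> \<delta> < 1 \<longrightarrow> x0 \<in> Rd d \<longrightarrow>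
         (\<forall>i\<in>{1..n}. f i \<in> smooth_class d L) \<longrightarrow>
         polyak_lojasiewicz d \<mu> F \<longrightarrow>
         minimizers d F \<noteq> {} \<longrightarrow> compact (minimizers d F) \<longrightarrow>
         real K \<ge> 10 * \<kappa> * ln (sqrt (real n) * real K) \<longrightarrow>
         (\<exists>c. 0 \<le> c \<and> c \<le> C L G * \<kappa> ^ 3 \<and>
           measure_pmf.prob (shuffles_pmf n K)
             {\<sigma>. (MIN k\<in>{1..K + 1}. F (start \<sigma> k)) - Fstar
                  \<le> (F x0 - Fstar) / (real n * real K ^ 2)
                    + c * (ln (real n * real K)) ^ 2 * ln (real n * real K / \<delta>)
                      / (real n * real K ^ 2)}
           \<ge> 1 - \<delta>)"
proof (rule exI[of _ "\<lambda>L G. 1920 * (G + 1)\<^sup>2 / L"], unfold Let_def, intro allI impI, goal_cases)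
  case (1 n d f L \<mu> x0 K \<delta>)
  show ?case
  proof (rule exI[of _ "1920 * (grad_bound d n f x0 + 1)\<^sup>2 / L * (L / \<mu>) ^ 3"], intro conjI)
    show "0 \<le> 1920 * (grad_bound d n f x0 + 1)\<^sup>2 / L * (L / \<mu>) ^ 3"
      using 1 by simp
  qed (use 1 in \<open>simp, intro random_shuffle_bound, auto\<close>)
qed

end
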